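(* Let $\Omega\subseteq\mathbb{R}^3$ be non-empty and open. For the operator $\begin{pmatrix}-\operatorname{curl}\\ \iota_{\operatorname{curl}}^{*}\end{pmatrix}\colon H(\operatorname{curl},\Omega)\subseteq L^2(\Omega)^3\to L^2(\Omega)^3\oplus\mathcal{BD}(\operatorname{curl})$ we have $$\begin{pmatrix}-\operatorname{curl}\\ \iota_{\operatorname{curl}}^{*}\end{pmatrix}^{*}\subseteq\begin{pmatrix}-\operatorname{curl}&0\end{pmatrix}$$ and $$D\left(\begin{pmatrix}-\operatorname{curl}\\ \iota_{\operatorname{curl}}^{*}\end{pmatrix}^{*}\right)=\left\{(E,\eta)\in D(\operatorname{curl})\times\mathcal{BD}(\operatorname{curl})\;\middle|\;\iota_{\operatorname{curl}}^{*}E-\stackrel{\bullet}{\operatorname{curl}}\eta=0\right\}.$$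
   Context: $H(\operatorname{curl},\Omega)=D(\operatorname{curl})$ is the space of fields in $L^2(\Omega)^3$ with distributional curl in $L^2(\Omega)^3$, with the graph inner product. $\mathring{\operatorname{curl}}$ is the closure in $L^2(\Omega)^3$ of $\operatorname{curl}$ restricted to smooth compactly supported vector fields on $\Omega$ (so $\operatorname{curl}=(\mathring{\operatorname{curl}})^{*}$), and $H(\mathring{\operatorname{curl}},\Omega)=D(\mathring{\operatorname{curl}})$ is a closed subspace of $H(\operatorname{curl},\Omega)$. $\mathcal{BD}(\operatorname{curl}):=H(\mathring{\operatorname{curl}},\Omega)^{\perp}$, the orthogonal complement in $H(\operatorname{curl},\Omega)$, with the inherited inner product; one has $\mathcal{BD}(\operatorname{curl})=N(1+\operatorname{curl}\operatorname{curl})$ (null space), and hence $\operatorname{curl}[\mathcal{BD}(\operatorname{curl})]\subseteq\mathcal{BD}(\operatorname{curl})$. $\iota_{\operatorname{curl}}\colon\mathcal{BD}(\operatorname{curl})\to H(\operatorname{curl},\Omega)$ is the canonical embedding and $\iota_{\operatorname{curl}}^{*}\colon H(\operatorname{curl},\Omega)\to\mathcal{BD}(\operatorname{curl})$ its adjoint. $\stackrel{\bullet}{\operatorname{curl}}\colon\mathcal{BD}(\operatorname{curl})\to\mathcal{BD}(\operatorname{curl})$ is defined by $\stackrel{\bullet}{\operatorname{curl}}\phi:=\iota_{\operatorname{curl}}^{*}\operatorname{curl}\iota_{\operatorname{curl}}\phi$. The operator $(-\operatorname{curl}\ \ 0)$ has domain $D(\operatorname{curl})\times\mathcal{BD}(\operatorname{curl})$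 and maps $(E,\eta)$ to $-\operatorname{curl}E$; $\subseteq$ between operators means extension. *)

theory Defs
  imports "HOL-Analysis.Analysis"
begin

section \<open>Scalars\<close>

text \<open>
  The Hilbert spaces may be real or complex. A finite-dimensional real normed field is \<open>\<real>\<close> or
  \<open>\<complex>\<close>, and the second axiom then determines \<open>scalar_cnj\<close>, so this class has no further models.
\<close>

class rc_scalar = real_normed_field + euclidean_space +
  fixes scalar_cnj :: "'a \<Rightarrow> 'a"
  assumes scalar_cnj_add: "scalar_cnj (x + y) = scalar_cnj x + scalar_cnj y"
    and mult_scalar_cnj_self: "x * scalar_cnj x = (norm x)\<^sup>2 *\<^sub>R 1"

instantiation real :: rc_scalar
begin
definition scalar_cnj_real :: "real \<Rightarrow> real" where "scalar_cnj_real x = x"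
instance by standard (simp_all add: scalar_cnj_real_def power2_eq_square)
end

instantiation complex :: rc_scalar
begin
definition scalar_cnj_complex :: "complex \<Rightarrow> complex" where "scalar_cnj_complex = cnj"
instance by standard (simp_all add: scalar_cnj_complex_def scaleR_conv_of_real complex_norm_square [symmetric] del: of_real_power)
end


section \<open>Hilbert spaces and operators on them\<close>

text \<open>
  Only the operations that are used are recorded; inner products are conjugate linear in the
  first argument.
\<close>

record ('v, 'k) ip_space =
  pts :: "'v set"
  zer :: 'v
  sub :: "'v \<Rightarrow> 'v \<Rightarrow> 'v"
  ip :: "'v \<Rightarrow> 'v \<Rightarrow> 'k"

definition neg :: "('v, 'k::rc_scalar) ip_space \<Rightarrow> 'v \<Rightarrow> 'v" where
  "neg X u = sub X (zer X) u"

definition nrm :: "('v, 'k::rc_scalar) ip_space \<Rightarrow> 'v \<Rightarrow> real" where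
  "nrm X u = sqrt (norm (ip X u u))"

definition direct_sum ::
    "('v, 'k::rc_scalar) ip_space \<Rightarrow> ('w, 'k) ip_space \<Rightarrow> ('v \<times> 'w, 'k) ip_space"
  where
  "direct_sum X Y =
    \<lparr>pts = pts X \<times> pts Y,
     zer = (zer X, zer Y),
     sub = (\<lambda>u v. (sub X (fst u) (fst v), sub Y (snd u) (snd v))),
     ip = (\<lambda>u v. ip X (fst u) (fst v) + ip Y (snd u) (snd v))\<rparr>"

definition closure_in :: "('v, 'k::rc_scalar) ip_space \<Rightarrow> 'v set \<Rightarrow> 'v set" where
  "closure_in X A =
    {u \<in> pts X. \<exists>s. (\<forall>n. s n \<in> A) \<and> (\<lambda>n. nrm X (sub X (s n) u)) \<longlonglongrightarrow> 0}"

definition orth_compl :: "('v, 'k::rc_scalar) ip_space \<Rightarrow> 'v set \<Rightarrow> 'v set" where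
  "orth_compl X M = {u \<in> pts X. \<forall>m\<in>M. ip X m u = 0}"

definition subspace_of :: "('v, 'k::rc_scalar) ip_space \<Rightarrow> 'v set \<Rightarrow> ('v, 'k) ip_space" where
  "subspace_of X M = X\<lparr>pts := M\<rparr>"

text \<open>
  An operator is identified with its graph: its domain is \<open>Domain T\<close>, extension is inclusion,
  and \<open>S O T\<close> applies \<open>S\<close> first.
\<close>

type_synonym ('v, 'w) operator = "('v \<times> 'w) set"

definition app :: "('v, 'w) operator \<Rightarrow> 'v \<Rightarrow> 'w" where
  "app T u = (THE v. (u, v) \<in> T)"

definition adjoint_op ::
    "('v, 'k::rc_scalar) ip_space \<Rightarrow> ('w, 'k) ip_space \<Rightarrow> ('v, 'w) operator \<Rightarrow> ('w, 'v) operator"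
  where
  "adjoint_op X Y T =
    {(y, x). y \<in> pts Y \<and> x \<in> pts X \<and> (\<forall>(u, v)\<in>T. ip Y v y = ip X u x)}"

definition closure_op ::
    "('v, 'k::rc_scalar) ip_space \<Rightarrow> ('w, 'k) ip_space \<Rightarrow> ('v, 'w) operator \<Rightarrow> ('v, 'w) operator"
  where
  "closure_op X Y T = closure_in (direct_sum X Y) T"

definition neg_op :: "('w, 'k::rc_scalar) ip_space \<Rightarrow> ('v, 'w) operator \<Rightarrow> ('v, 'w) operator" where
  "neg_op Y T = {(u, neg Y v) | u v. (u, v) \<in> T}"

definition column_op ::
    "('v, 'w) operator \<Rightarrow> ('v, 'z) operator \<Rightarrow> ('v, 'w \<times> 'z) operator" where
  "column_op S T = {(u, (v, w)). (u, v) \<in> S \<and> (u, w) \<in> T}"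

text \<open>The domain \<open>Domain T\<close> with the graph inner product.\<close>

definition graph_space ::
    "('v, 'k::rc_scalar) ip_space \<Rightarrow> ('w, 'k) ip_space \<Rightarrow> ('v, 'w) operator \<Rightarrow> ('v, 'k) ip_space"
  where
  "graph_space X Y T =
    \<lparr>pts = Domain T,
     zer = zer X,
     sub = sub X,
     ip = (\<lambda>u v. ip X u v + ip Y (app T u) (app T v))\<rparr>"


section \<open>Square-integrable vector fields\<close>

type_synonym 'k vfield = "real^3 \<Rightarrow> 'k^3"

text \<open>
  Elements of \<open>L\<^sup>2(\<Omega>)\<^sup>3\<close> are almost-everywhere classes; values of representatives
  off \<open>\<Omega>\<close> are irrelevant.
\<close>

definition square_integrable :: "(real^3) set \<Rightarrow> ('k::rc_scalar) vfield set" where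
  "square_integrable \<Omega> =
    {f. f \<in> borel_measurable (lebesgue_on \<Omega>) \<and>
        integrable (lebesgue_on \<Omega>) (\<lambda>x. (norm (f x))\<^sup>2)}"

definition ae_class :: "(real^3) set \<Rightarrow> ('k::rc_scalar) vfield \<Rightarrow> 'k vfield set" where
  "ae_class \<Omega> f = {g \<in> square_integrable \<Omega>. AE x in lebesgue_on \<Omega>. g x = f x}"

definition rep :: "'k vfield set \<Rightarrow> 'k vfield" where
  "rep U = (SOME f. f \<in> U)"

definition L2 :: "(real^3) set \<Rightarrow> (('k::rc_scalar) vfield set, 'k) ip_space" where
  "L2 \<Omega> =
    \<lparr>pts = ae_class \<Omega> ` square_integrable \<Omega>,
     zer = ae_class \<Omega> (\<lambda>x. 0),
     sub = (\<lambda>U V. ae_class \<Omega> (\<lambda>x. rep U x - rep V x)),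
     ip = (\<lambda>U V. integral\<^sup>L (lebesgue_on \<Omega>) (\<lambda>x. \<Sum>i\<in>UNIV. scalar_cnj (rep U x $ i) * rep V x $ i))\<rparr>"


section \<open>The operator curl\<close>

definition partial_deriv :: "3 \<Rightarrow> (real^3 \<Rightarrow> 'b::real_normed_vector) \<Rightarrow> real^3 \<Rightarrow> 'b" where
  "partial_deriv i f x = frechet_derivative f (at x) (axis i 1)"

primrec C_k :: "nat \<Rightarrow> (real^3 \<Rightarrow> 'b::real_normed_vector) \<Rightarrow> bool" where
  "C_k 0 f \<longleftrightarrow> continuous_on UNIV f"
| "C_k (Suc k) f \<longleftrightarrow> (\<forall>x. f differentiable at x) \<and> (\<forall>i. C_k k (partial_deriv i f))"

text \<open>Smooth fields with compact support in \<open>\<Omega>\<close>, extended by zero to the whole space.\<close>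

definition test_fields :: "(real^3) set \<Rightarrow> ('k::rc_scalar) vfield set" where
  "test_fields \<Omega> =
    {\<phi>. (\<forall>k. C_k k \<phi>) \<and> compact (closure {x. \<phi> x \<noteq> 0}) \<and> closure {x. \<phi> x \<noteq> 0} \<subseteq> \<Omega>}"

definition classical_curl :: "('k::rc_scalar) vfield \<Rightarrow> 'k vfield" where
  "classical_curl \<phi> = (\<lambda>x. vector
    [partial_deriv 2 (\<lambda>y. \<phi> y $ 3) x - partial_deriv 3 (\<lambda>y. \<phi> y $ 2) x,
     partial_deriv 3 (\<lambda>y. \<phi> y $ 1) x - partial_deriv 1 (\<lambda>y. \<phi> y $ 3) x,
     partial_deriv 1 (\<lambda>y. \<phi> y $ 2) x - partial_deriv 2 (\<lambda>y. \<phi> y $ 1) x])"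

text \<open>The pairing of distributions with test fields is bilinear, hence the absence of \<open>scalar_cnj\<close>.\<close>

definition curl :: "(real^3) set \<Rightarrow> (('k::rc_scalar) vfield set, 'k vfield set) operator" where
  "curl \<Omega> = {(U, V). U \<in> pts (L2 \<Omega>) \<and> V \<in> pts (L2 \<Omega>) \<and>
    (\<forall>\<phi>\<in>test_fields \<Omega>.
      integral\<^sup>L (lebesgue_on \<Omega>) (\<lambda>x. \<Sum>i\<in>UNIV. rep U x $ i * classical_curl \<phi> x $ i) =
      integral\<^sup>L (lebesgue_on \<Omega>) (\<lambda>x. \<Sum>i\<in>UNIV. rep V x $ i * \<phi> x $ i))}"

definition curl_ring :: "(real^3) set \<Rightarrow> (('k::rc_scalar) vfield set, 'k vfield set) operator" where
  "curl_ring \<Omega> = closure_op (L2 \<Omega>) (L2 \<Omega>)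
    {(ae_class \<Omega> \<phi>, ae_class \<Omega> (classical_curl \<phi>)) | \<phi>. \<phi> \<in> test_fields \<Omega>}"

definition H_curl :: "(real^3) set \<Rightarrow> (('k::rc_scalar) vfield set, 'k) ip_space" where
  "H_curl \<Omega> = graph_space (L2 \<Omega>) (L2 \<Omega>) (curl \<Omega>)"


section \<open>Boundary data spaces\<close>

definition BD_curl :: "(real^3) set \<Rightarrow> (('k::rc_scalar) vfield set, 'k) ip_space" where
  "BD_curl \<Omega> = subspace_of (H_curl \<Omega>) (orth_compl (H_curl \<Omega>) (Domain (curl_ring \<Omega>)))"

definition iota_curl :: "(real^3) set \<Rightarrow> (('k::rc_scalar) vfield set, 'k vfield set) operator" where
  "iota_curl \<Omega> = Id_on (pts (BD_curl \<Omega>))"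

definition iota_curl_adj ::
    "(real^3) set \<Rightarrow> (('k::rc_scalar) vfield set, 'k vfield set) operator" where
  "iota_curl_adj \<Omega> = adjoint_op (BD_curl \<Omega>) (H_curl \<Omega>) (iota_curl \<Omega>)"

definition curl_bullet ::
    "(real^3) set \<Rightarrow> (('k::rc_scalar) vfield set, 'k vfield set) operator" where
  "curl_bullet \<Omega> = iota_curl \<Omega> O curl \<Omega> O iota_curl_adj \<Omega>"

definition neg_curl_iota_adj ::
    "(real^3) set \<Rightarrow>
      (('k::rc_scalar) vfield set, 'k vfield set \<times> 'k vfield set) operator" where
  "neg_curl_iota_adj \<Omega> = column_op (neg_op (L2 \<Omega>) (curl \<Omega>)) (iota_curl_adj \<Omega>)"

definition neg_curl_zero ::
    "(real^3) set \<Rightarrow>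
      (('k::rc_scalar) vfield set \<times> 'k vfield set, 'k vfield set) operator" where
  "neg_curl_zero \<Omega> =
    {((E, \<eta>), F) | E \<eta> F. (E, F) \<in> neg_op (L2 \<Omega>) (curl \<Omega>) \<and> \<eta> \<in> pts (BD_curl \<Omega>)}"

end

theory Submission
  imports Defs
begin

text \<open>
  Let \<open>w = E - curl \<eta>\<close>, so that \<open>curl w = curl E + \<eta>\<close>. Testing the adjoint relation with test
  fields, whose projection onto the boundary data vanishes, gives the first claim. What remains of
  the relation is \<open>\<langle>F, curl w\<rangle> = \<langle>curl F, w\<rangle>\<close> for all \<open>F\<close> in the domain of curl. Inserting
  \<open>F = curl \<phi>\<close> with a boundary datum \<open>\<phi>\<close>, for which \<open>curl curl \<phi> = -\<phi>\<close>, shows that \<open>w\<close> is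
  orthogonal to the boundary data in the graph inner product. Conversely, if \<open>w\<close> is orthogonal to
  the boundary data then, by the projection theorem, it lies in the domain of the closure of curl
  on test fields, and there the relation holds because the weak curl is the adjoint of that closure.
\<close>

section \<open>The scalar field\<close>

text \<open>The choice of \<open>w\<close> comes from \<open>curl (curl \<eta>) = - \<eta>\<close>:
  with \<open>F = curl \<phi>\<close> the remaining relation reads
  \<open><curl \<phi>, curl w> + <\<phi>, w> = 0\<close>, and its left side is the graph inner
  product itself. The operator argument thus needs few facts about curl, but each costs some
  analysis. That the weak curl is single-valued is the fundamental lemma, hence the smooth cutoffs.
  That it extends the closure is integration by parts without boundary terms. The projection onto
  the closed graph is completeness of the square-integrable functions. Completeness and the
  minimisation are carried out for functions with values in a real Euclidean space, not for classes
  and not with scalar-valued products. Orthogonality therefore first appears for the real part only,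
  and multiplying a test field by a fixed scalar recovers the rest. Likewise distributions are
  paired bilinearly but adjoints sesquilinearly; conjugating the test fields reconciles the
  two.\<close>

lemma scalar_cnj_0 [simp]: "scalar_cnj (0::'k::rc_scalar) = 0"
  using scalar_cnj_add [of "0::'k" 0] by simp

text \<open>A nonzero scalar has only one partner with the product required by the class axiom. The
  algebraic laws that follow multiply out a candidate for the conjugate and compare, with zero
  treated apart.\<close>

lemma scalar_cnj_unique:
  fixes a b :: "'k::rc_scalar"
  assumes "a \<noteq> 0" "a * b = (norm a)\<^sup>2 *\<^sub>R 1"
  shows "b = scalar_cnj a"
  by (metis assms mult_scalar_cnj_self mult_left_cancel)

lemma norm_scalar_cnj [simp]: "norm (scalar_cnj (a::'k::rc_scalar)) = norm a"
proof (cases "a = 0")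
  case False
  have "norm a * norm (scalar_cnj a) = (norm a)\<^sup>2"
    by (simp add: mult_scalar_cnj_self flip: norm_mult)
  then show ?thesis
    using False by (simp add: power2_eq_square)
qed auto

lemma scalar_cnj_mult: "scalar_cnj (a * b :: 'k::rc_scalar) = scalar_cnj a * scalar_cnj b"
proof (cases "a = 0 \<or> b = 0")
  case False
  have "a * b * (scalar_cnj a * scalar_cnj b) = (a * scalar_cnj a) * (b * scalar_cnj b)"
    by (simp add: ac_simps)
  also have "\<dots> = (norm (a * b))\<^sup>2 *\<^sub>R 1"
    by (simp add: mult_scalar_cnj_self norm_mult power_mult_distrib)
  finally show ?thesis
    using False scalar_cnj_unique [of "a * b"] by simp
qed auto

lemma scalar_cnj_scaleR: "scalar_cnj (r *\<^sub>R a :: 'k::rc_scalar) = r *\<^sub>R scalar_cnj a"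
proof (cases "r = 0 \<or> a = 0")
  case False
  have "(r *\<^sub>R a) * (r *\<^sub>R scalar_cnj a) = (r * r) *\<^sub>R (a * scalar_cnj a)"
    by simp
  also have "\<dots> = (norm (r *\<^sub>R a))\<^sup>2 *\<^sub>R 1"
    unfolding mult_scalar_cnj_self by (simp add: power_mult_distrib power2_eq_square)
  finally have "(r *\<^sub>R a) * (r *\<^sub>R scalar_cnj a) = (norm (r *\<^sub>R a))\<^sup>2 *\<^sub>R 1" .
  then show ?thesis
    using False scalar_cnj_unique [of "r *\<^sub>R a" "r *\<^sub>R scalar_cnj a"] by (metis scaleR_eq_0_iff)
qed auto

lemma scalar_cnj_cnj [simp]: "scalar_cnj (scalar_cnj (a::'k::rc_scalar)) = a"
proof (cases "a = 0")
  case False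
  have "scalar_cnj a * a = (norm (scalar_cnj a))\<^sup>2 *\<^sub>R 1"
    by (simp add: mult_scalar_cnj_self mult.commute)
  moreover have "scalar_cnj a \<noteq> 0"
    using False by (metis norm_scalar_cnj norm_eq_zero)
  ultimately show ?thesis
    using scalar_cnj_unique by metis
qed auto

lemma bounded_linear_scalar_cnj: "bounded_linear (scalar_cnj :: 'k::rc_scalar \<Rightarrow> 'k)"
  by (rule bounded_linear_intro [where K = 1]) (simp_all add: scalar_cnj_add scalar_cnj_scaleR)

lemmas scalar_cnj_diff = linear_diff [OF bounded_linear.linear [OF bounded_linear_scalar_cnj]]
lemmas scalar_cnj_sum = linear_sum [OF bounded_linear.linear [OF bounded_linear_scalar_cnj]]

text \<open>By polarisation the inner product is a combination of squared norms, and the norm is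
  multiplicative.\<close>

lemma inner_mult_left_same:
  fixes c x y :: "'a::{real_normed_field, real_inner}"
  shows "inner (c * x) (c * y) = (norm c)\<^sup>2 * inner x y"
  by (simp add: dot_norm norm_mult power_mult_distrib right_diff_distrib flip: distrib_left)

text \<open>Makes \<open>inner 1\<close> play the role of the real part. Multiplication by
  \<open>scalar_cnj a\<close> scales inner products by \<open>(norm a)\<^sup>2\<close> and sends
  \<open>a\<close> to a real multiple of one, so this factor can be cancelled.\<close>

lemma inner_one_scalar_cnj: "inner 1 (scalar_cnj a * b) = inner (a::'k::rc_scalar) b"
proof (cases "a = 0")
  case False
  have "(norm a)\<^sup>2 * inner 1 (scalar_cnj a * b) = inner (scalar_cnj a * a) (scalar_cnj a * b)"
    by (simp add: mult_scalar_cnj_self mult.commute [of _ a])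
  also have "\<dots> = (norm a)\<^sup>2 * inner a b"
    by (simp only: inner_mult_left_same norm_scalar_cnj)
  finally show ?thesis
    using False by simp
qed auto

section \<open>The sesquilinear product of scalar vectors\<close>

definition vdot :: "'k::rc_scalar^'n \<Rightarrow> 'k^'n \<Rightarrow> 'k" where
  "vdot u v = (\<Sum>i\<in>UNIV. scalar_cnj (u $ i) * v $ i)"

lemma vdot_diff_right: "vdot u (v - w) = vdot u v - vdot u w"
  by (simp add: vdot_def algebra_simps sum_subtractf)

lemma vdot_mult_left: "vdot (\<chi> i. c * u $ i) v = scalar_cnj c * vdot u v"
  by (simp add: vdot_def scalar_cnj_mult sum_distrib_left mult.assoc)

lemma vdot_commute: "vdot v u = scalar_cnj (vdot u v)"
  by (simp add: vdot_def scalar_cnj_sum scalar_cnj_mult mult.commute)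

lemma inner_one_vdot: "inner 1 (vdot u v) = inner u v"
  by (simp add: vdot_def inner_sum_right inner_one_scalar_cnj inner_vec_def)

lemma vdot_self: "vdot u u = (norm u)\<^sup>2 *\<^sub>R 1"
  by (simp add: vdot_def mult.commute [of "scalar_cnj _"] mult_scalar_cnj_self norm_vec_def
      L2_set_def sum_nonneg flip: scaleR_sum_left)

lemma norm_vdot_le: "norm (vdot u v) \<le> norm u * norm v"
proof -
  have "norm (vdot u v) \<le> (\<Sum>i\<in>UNIV. \<bar>norm (u $ i)\<bar> * \<bar>norm (v $ i)\<bar>)"
    unfolding vdot_def by (rule sum_norm_le) (simp add: norm_mult)
  also have "\<dots> \<le> norm u * norm v"
    unfolding norm_vec_def by (rule L2_set_mult_ineq)
  finally show ?thesis .
qed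

section \<open>Square-integrable functions on a measure space\<close>

text \<open>Stated for any measure and any Euclidean target, because the projection is later applied
  to pairs of fields and the Cauchy-Schwarz inequality to norms of fields.\<close>

definition sq_integrable :: "'a measure \<Rightarrow> ('a \<Rightarrow> 'b::euclidean_space) \<Rightarrow> bool" where
  "sq_integrable M f \<longleftrightarrow> f \<in> borel_measurable M \<and> integrable M (\<lambda>x. (norm (f x))\<^sup>2)"

lemma sq_integrable_measurable [measurable_dest]: "sq_integrable M f \<Longrightarrow> f \<in> borel_measurable M"
  by (simp add: sq_integrable_def)

lemma sq_integrable_bound:
  fixes f :: "'a \<Rightarrow> 'b::euclidean_space" and g :: "'a \<Rightarrow> 'c::euclidean_space"
  assumes "sq_integrable M g" "f \<in> borel_measurable M" "\<And>x. norm (f x) \<le> C * norm (g x)"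
  shows "sq_integrable M f"
  unfolding sq_integrable_def
proof
  show "integrable M (\<lambda>x. (norm (f x))\<^sup>2)"
  proof (rule Bochner_Integration.integrable_bound)
    show "integrable M (\<lambda>x. C\<^sup>2 * (norm (g x))\<^sup>2)"
      using assms(1) by (simp add: sq_integrable_def)
    show "AE x in M. norm ((norm (f x))\<^sup>2) \<le> norm (C\<^sup>2 * (norm (g x))\<^sup>2)"
      using assms(3) by (auto simp: intro!: power_mono simp flip: power_mult_distrib)
  qed (use assms(2) in measurable)
qed fact

lemma sq_integrable_bounded_linear:
  fixes f :: "'a \<Rightarrow> 'b::euclidean_space" and L :: "'b \<Rightarrow> 'c::euclidean_space"
  assumes "bounded_linear L" "sq_integrable M f"
  shows "sq_integrable M (\<lambda>x. L (f x))"
proof -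
  obtain K where "\<And>x. norm (L x) \<le> norm x * K"
    using assms(1) bounded_linear.bounded by blast
  then show ?thesis
    by (intro sq_integrable_bound [OF assms(2), where C = K])
      (auto simp: mult.commute intro: borel_measurable_continuous_on linear_continuous_on
        assms sq_integrable_measurable [OF assms(2)])
qed

lemma norm_add_power2_le: "(norm (a + b))\<^sup>2 \<le> 2 * (norm a)\<^sup>2 + 2 * (norm (b::'a::real_normed_vector))\<^sup>2"
proof -
  have "(norm (a + b))\<^sup>2 \<le> (norm a + norm b)\<^sup>2"
    by (simp add: norm_triangle_ineq power_mono)
  also have "\<dots> \<le> 2 * (norm a)\<^sup>2 + 2 * (norm b)\<^sup>2"
    using sum_squares_bound [of "norm a" "norm b"] by (simp add: power2_sum)
  finally show ?thesis .
qed

lemma sq_integrable_add: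
  assumes [measurable]: "sq_integrable M f" "sq_integrable M g"
  shows "sq_integrable M (\<lambda>x. f x + g x)"
  unfolding sq_integrable_def
proof
  show "integrable M (\<lambda>x. (norm (f x + g x))\<^sup>2)"
  proof (rule Bochner_Integration.integrable_bound)
    show "integrable M (\<lambda>x. 2 * (norm (f x))\<^sup>2 + 2 * (norm (g x))\<^sup>2)"
      using assms by (simp add: sq_integrable_def)
  qed (use norm_add_power2_le in auto)
qed measurable

lemma sq_integrable_scaleR: "sq_integrable M f \<Longrightarrow> sq_integrable M (\<lambda>x. c *\<^sub>R f x)"
  by (rule sq_integrable_bounded_linear [OF bounded_linear_scaleR_right])

lemma sq_integrable_diff:
  "sq_integrable M f \<Longrightarrow> sq_integrable M g \<Longrightarrow> sq_integrable M (\<lambda>x. f x - g x)"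
  using sq_integrable_add [OF _ sq_integrable_scaleR [where c = "-1"]] by fastforce

lemma sq_integrable_zero: "sq_integrable M (\<lambda>x. 0)"
  by (simp add: sq_integrable_def)

lemma sq_integrable_Pair:
  fixes f :: "'a \<Rightarrow> 'b::euclidean_space" and g :: "'a \<Rightarrow> 'c::euclidean_space"
  assumes "sq_integrable M f" "sq_integrable M g"
  shows "sq_integrable M (\<lambda>x. (f x, g x))"
  using assms by (auto simp: sq_integrable_def norm_Pair)

lemma integrable_norm_power2: "sq_integrable M f \<Longrightarrow> integrable M (\<lambda>x. (norm (f x))\<^sup>2)"
  by (simp add: sq_integrable_def)

section \<open>Cauchy-Schwarz inequality, completeness and projection\<close>

lemma sq_integrable_integrable_bound:
  fixes h :: "'a \<Rightarrow> 'd::{banach, second_countable_topology}"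
  assumes f: "sq_integrable M f" and g: "sq_integrable M g"
    and h: "h \<in> borel_measurable M" "\<And>x. norm (h x) \<le> norm (f x) * norm (g x)"
  shows "integrable M h"
proof (rule Bochner_Integration.integrable_bound)
  show "integrable M (\<lambda>x. (norm (f x))\<^sup>2 + (norm (g x))\<^sup>2)"
    using f g by (simp add: sq_integrable_def)
  show "AE x in M. norm (h x) \<le> norm ((norm (f x))\<^sup>2 + (norm (g x))\<^sup>2)"
  proof (rule AE_I2)
    fix x
    have "norm (f x) * norm (g x) \<le> (norm (f x))\<^sup>2 + (norm (g x))\<^sup>2"
      using sum_squares_bound [of "norm (f x)" "norm (g x)"]
        mult_nonneg_nonneg [OF norm_ge_zero norm_ge_zero, of "f x" "g x"]
      unfolding mult.assoc by linarith
    then show "norm (h x) \<le> norm ((norm (f x))\<^sup>2 + (norm (g x))\<^sup>2)"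
      using h(2) [of x] by simp
  qed
qed fact

lemma integrable_inner_sq_integrable:
  assumes [measurable]: "sq_integrable M f" "sq_integrable M g"
  shows "integrable M (\<lambda>x. inner (f x) (g x))"
  by (rule sq_integrable_integrable_bound [OF assms]) (auto simp: Cauchy_Schwarz_ineq2)

lemma integral_norm_diff_power2:
  assumes "sq_integrable M f" "sq_integrable M g"
  shows "(\<integral>x. (norm (f x - t *\<^sub>R g x))\<^sup>2 \<partial>M) =
    (\<integral>x. (norm (f x))\<^sup>2 \<partial>M) - 2 * t * (\<integral>x. inner (f x) (g x) \<partial>M) + t\<^sup>2 * (\<integral>x. (norm (g x))\<^sup>2 \<partial>M)"
proof -
  have "(norm (f x - t *\<^sub>R g x))\<^sup>2 =
      (norm (f x))\<^sup>2 - 2 * t * inner (f x) (g x) + t\<^sup>2 * (norm (g x))\<^sup>2" for x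
    unfolding power2_norm_eq_inner
    by (simp add: inner_diff inner_commute algebra_simps power2_eq_square)
  then show ?thesis
    using assms by (simp add: integrable_inner_sq_integrable integrable_norm_power2)
qed

text \<open>For positive \<open>C\<close> the parameter \<open>B / C\<close> minimises the
  quadratic. Serves the Cauchy-Schwarz inequality and, with \<open>A = 0\<close>, the orthogonality
  at a minimiser.\<close>

lemma quadratic_nonneg_imp_discriminant:
  fixes A B C :: real
  assumes "\<And>t. 0 \<le> A - 2 * t * B + t\<^sup>2 * C" "0 \<le> C"
  shows "B\<^sup>2 \<le> A * C"
proof (cases "C = 0")
  case True
  \<comment> \<open>If \<open>B\<close> were nonzero, the parameter \<open>(A + 1) / (2 * B)\<close>
    would give the expression the value -1.\<close>
  have "B = 0"
    using assms(1) [of "(A + 1) / (2 * B)"] True by (cases "B = 0") (auto simp: field_simps)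
  then show ?thesis
    using True by simp
next
  case False
  then have "A - B\<^sup>2 / C \<ge> 0"
    using assms(1) [of "B / C"] by (simp add: power2_eq_square)
  then show ?thesis
    using False assms(2) by (simp add: field_simps)
qed

lemma integral_Cauchy_Schwarz:
  assumes "sq_integrable M f" "sq_integrable M g"
  shows "(\<integral>x. inner (f x) (g x) \<partial>M)\<^sup>2 \<le> (\<integral>x. (norm (f x))\<^sup>2 \<partial>M) * (\<integral>x. (norm (g x))\<^sup>2 \<partial>M)"
proof (rule quadratic_nonneg_imp_discriminant)
  fix t
  have "0 \<le> (\<integral>x. (norm (f x - t *\<^sub>R g x))\<^sup>2 \<partial>M)"
    by simp
  then show "0 \<le> (\<integral>x. (norm (f x))\<^sup>2 \<partial>M) - 2 * t * (\<integral>x. inner (f x) (g x) \<partial>M)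
      + t\<^sup>2 * (\<integral>x. (norm (g x))\<^sup>2 \<partial>M)"
    by (simp only: integral_norm_diff_power2 [OF assms])
qed simp

text \<open>Continuity of the pairing in its first argument: by Cauchy-Schwarz the squared error is
  at most a constant times the squared distance.\<close>

lemma tendsto_integral_inner:
  assumes s: "\<And>n. sq_integrable M (s n)" and f: "sq_integrable M f" and g: "sq_integrable M g"
    and lim: "(\<lambda>n. \<integral>x. (norm (s n x - f x))\<^sup>2 \<partial>M) \<longlonglongrightarrow> 0"
  shows "(\<lambda>n. \<integral>x. inner (s n x) (g x) \<partial>M) \<longlonglongrightarrow> (\<integral>x. inner (f x) (g x) \<partial>M)"
proof -
  have d: "sq_integrable M (\<lambda>x. s n x - f x)" for n
    by (intro sq_integrable_diff s f)
  have "(\<lambda>n. (\<integral>x. inner (s n x - f x) (g x) \<partial>M)\<^sup>2) \<longlonglongrightarrow> 0"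
  proof (rule tendsto_sandwich [OF _ _ tendsto_const])
    show "(\<lambda>n. (\<integral>x. (norm (s n x - f x))\<^sup>2 \<partial>M) * (\<integral>x. (norm (g x))\<^sup>2 \<partial>M)) \<longlonglongrightarrow> 0"
      using tendsto_mult_left_zero [OF lim] .
  qed (auto intro!: always_eventually integral_Cauchy_Schwarz [OF d g])
  then have "(\<lambda>n. \<integral>x. inner (s n x - f x) (g x) \<partial>M) \<longlonglongrightarrow> 0"
    by (simp add: tendsto_null_power)
  moreover have "(\<integral>x. inner (s n x - f x) (g x) \<partial>M)
      = (\<integral>x. inner (s n x) (g x) \<partial>M) - (\<integral>x. inner (f x) (g x) \<partial>M)" for n
    by (simp add: inner_diff_left integrable_inner_sq_integrable s f g)
  ultimately show ?thesis
    by (simp add: LIM_zero_iff)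
qed

text \<open>Completeness for sequences that are Cauchy at a geometric rate. The rate makes the
  increments summable at almost every point, which produces a pointwise limit; Fatou's lemma then
  turns it into a limit in the mean.\<close>

lemma sq_integrable_complete:
  fixes s :: "nat \<Rightarrow> 'a \<Rightarrow> 'b::euclidean_space"
  assumes s: "\<And>n. sq_integrable M (s n)"
    and bd: "\<And>n k. n \<le> k \<Longrightarrow> (\<integral>x. (norm (s k x - s n x))\<^sup>2 \<partial>M) \<le> C * (1/8) ^ n"
  obtains g where "sq_integrable M g" "(\<lambda>n. \<integral>x. (norm (s n x - g x))\<^sup>2 \<partial>M) \<longlonglongrightarrow> 0"
proof -
  have [measurable]: "s n \<in> borel_measurable M" for n
    using s by (simp add: sq_integrable_def)
  have d: "integrable M (\<lambda>x. (norm (s k x - s n x))\<^sup>2)" for n k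
    by (intro integrable_norm_power2 sq_integrable_diff s)
  \<comment> \<open>The weight \<open>4 ^ n\<close> is small enough against \<open>(1/8) ^ n\<close>
    for the integrals of \<open>q n\<close> to be summable, and large enough for a pointwise bound
    on \<open>q n x\<close> to force increments of order \<open>(1/2) ^ n\<close>.\<close>
  define q where "q n x = 4 ^ n * (norm (s (Suc n) x - s n x))\<^sup>2" for n x
  have [measurable]: "q n \<in> borel_measurable M" for n
    unfolding q_def by measurable
  have C: "0 \<le> C"
    using order.trans [OF _ bd [of 0 0]] by simp
  have q: "(\<integral>\<^sup>+x. q n x \<partial>M) \<le> ennreal (C * (1/2) ^ n)" for n
  proof -
    have "(\<integral>\<^sup>+x. q n x \<partial>M) = ennreal (\<integral>x. q n x \<partial>M)"
      by (rule nn_integral_eq_integral) (use d in \<open>auto simp: q_def\<close>)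
    also have "(\<integral>x. q n x \<partial>M) = 4 ^ n * (\<integral>x. (norm (s (Suc n) x - s n x))\<^sup>2 \<partial>M)"
      by (simp add: q_def)
    also have "\<dots> \<le> 4 ^ n * (C * (1/8) ^ n)"
      by (intro mult_left_mono bd) auto
    also have "\<dots> = C * (1/2) ^ n"
      by (simp add: power_divide flip: power_mult_distrib)
        (simp add: field_simps flip: power_mult_distrib)
    finally show ?thesis
      by (simp add: ennreal_leI)
  qed
  have "(\<integral>\<^sup>+x. (\<Sum>n. ennreal (q n x)) \<partial>M) = (\<Sum>n. \<integral>\<^sup>+x. q n x \<partial>M)"
    by (rule nn_integral_suminf) simp
  also have "\<dots> \<le> (\<Sum>n. ennreal (C * (1/2) ^ n))"
    by (intro suminf_le q) auto
  also have "\<dots> = ennreal (\<Sum>n. C * (1/2) ^ n)"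
    using C by (intro suminf_ennreal2) (auto intro!: summable_mult summable_geometric)
  finally have "(\<integral>\<^sup>+x. (\<Sum>n. ennreal (q n x)) \<partial>M) \<noteq> \<infinity>"
    by (auto simp: top_unique)
  then have "AE x in M. (\<Sum>n. ennreal (q n x)) \<noteq> \<infinity>"
    by (intro nn_integral_noteq_infinite) auto
  then have conv: "AE x in M. convergent (\<lambda>n. s n x)"
  proof eventually_elim
    case (elim x)
    have "summable (\<lambda>n. q n x)"
      using elim by (intro summable_suminf_not_top) (auto simp: q_def)
    then have "bounded (range (\<lambda>n. q n x))"
      using convergent_imp_bounded summable_LIMSEQ_zero by blast
    then obtain K where K: "\<And>n. norm (q n x) \<le> K"
      by (auto simp: bounded_iff)
    have K0: "0 \<le> K"
      using order.trans [OF norm_ge_zero K] .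
    have "norm (s (Suc n) x - s n x) \<le> sqrt K * (1/2) ^ n" for n
    proof (rule power2_le_imp_le)
      have "4 ^ n * (norm (s (Suc n) x - s n x))\<^sup>2 \<le> K"
        using K [of n] by (simp add: q_def)
      then have "(norm (s (Suc n) x - s n x))\<^sup>2 \<le> K / 4 ^ n"
        by (simp add: field_simps)
      also have "K / 4 ^ n = (sqrt K * (1/2) ^ n)\<^sup>2"
      proof -
        have "((1/2::real) ^ n)\<^sup>2 = 1 / 4 ^ n"
          by (simp add: power_divide flip: power_mult) (simp add: power_mult mult.commute [of n])
        then show ?thesis
          using K0 by (simp add: power_mult_distrib)
      qed
      finally show "(norm (s (Suc n) x - s n x))\<^sup>2 \<le> (sqrt K * (1/2) ^ n)\<^sup>2" .
    qed (use K0 in simp)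
    then have "summable (\<lambda>n. s (Suc n) x - s n x)"
      by (rule summable_comparison_test' [where N = 0, rotated])
        (auto intro!: summable_mult summable_geometric)
    then have "convergent (\<lambda>n. \<Sum>k<n. s (Suc k) x - s k x)"
      by (simp add: summable_iff_convergent)
    then have "convergent (\<lambda>n. (s n x - s 0 x) + s 0 x)"
      by (intro convergent_add convergent_const) (simp add: sum_lessThan_telescope [of "\<lambda>k. s k x"])
    then show ?case
      by simp
  qed
  \<comment> \<open>Where the sequence diverges, \<open>lim\<close> has an unspecified value; this
    happens on a null set only, and measurability holds regardless.\<close>
  define g where "g x = lim (\<lambda>n. s n x)" for x
  have [measurable]: "g \<in> borel_measurable M"
    unfolding g_def by (rule borel_measurable_lim_metric) simp
  \<comment> \<open>For fixed \<open>n\<close> the integrand is almost everywhere the limit of the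
    squared norms of \<open>s k x - s n x\<close> as \<open>k\<close> grows, so the Cauchy bound
    passes to \<open>g\<close>.\<close>
  have Fatou: "(\<integral>\<^sup>+x. (norm (s n x - g x))\<^sup>2 \<partial>M) \<le> ennreal (C * (1/8) ^ n)" for n
  proof -
    have "AE x in M. ennreal ((norm (s n x - g x))\<^sup>2) = liminf (\<lambda>k. ennreal ((norm (s k x - s n x))\<^sup>2))"
      using conv
    proof eventually_elim
      case (elim x)
      then have "(\<lambda>k. s k x) \<longlonglongrightarrow> g x"
        by (simp add: g_def convergent_LIMSEQ_iff)
      then have "(\<lambda>k. ennreal ((norm (s k x - s n x))\<^sup>2)) \<longlonglongrightarrow> ennreal ((norm (g x - s n x))\<^sup>2)"
        by (intro tendsto_intros)
      from lim_imp_Liminf [OF sequentially_bot this] show ?case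
        by (simp only: norm_minus_commute)
    qed
    then have "(\<integral>\<^sup>+x. (norm (s n x - g x))\<^sup>2 \<partial>M)
        = (\<integral>\<^sup>+x. liminf (\<lambda>k. ennreal ((norm (s k x - s n x))\<^sup>2)) \<partial>M)"
      by (rule nn_integral_cong_AE)
    also have "\<dots> \<le> liminf (\<lambda>k. \<integral>\<^sup>+x. (norm (s k x - s n x))\<^sup>2 \<partial>M)"
      by (rule nn_integral_liminf) simp
    also have "\<dots> \<le> liminf (\<lambda>k. ennreal (C * (1/8) ^ n))"
    proof (rule Liminf_mono)
      show "\<forall>\<^sub>F k in sequentially. (\<integral>\<^sup>+x. (norm (s k x - s n x))\<^sup>2 \<partial>M) \<le> ennreal (C * (1/8) ^ n)"
        using eventually_ge_at_top [of n]
      proof eventually_elim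
        case (elim k)
        have "(\<integral>\<^sup>+x. (norm (s k x - s n x))\<^sup>2 \<partial>M) = ennreal (\<integral>x. (norm (s k x - s n x))\<^sup>2 \<partial>M)"
          by (rule nn_integral_eq_integral) (use d in auto)
        then show ?case
          using bd [OF elim] by (simp add: ennreal_leI)
      qed
    qed
    also have "\<dots> = ennreal (C * (1/8) ^ n)"
      by (simp add: Liminf_const)
    finally show ?thesis .
  qed
  have sg: "integrable M (\<lambda>x. (norm (s n x - g x))\<^sup>2)" for n
    by (rule integrableI_nonneg) (use Fatou [of n] in \<open>auto simp: top_unique less_top [symmetric]\<close>)
  \<comment> \<open>Finite distance from \<open>s 0\<close> makes \<open>g\<close> itself
    square-integrable.\<close>
  have "sq_integrable M (\<lambda>x. s 0 x - (s 0 x - g x))"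
    by (rule sq_integrable_diff [OF s]) (simp add: sq_integrable_def sg)
  then have "sq_integrable M g"
    by simp
  moreover have "(\<lambda>n. \<integral>x. (norm (s n x - g x))\<^sup>2 \<partial>M) \<longlonglongrightarrow> 0"
  proof (rule tendsto_sandwich [OF _ _ tendsto_const])
    show "(\<lambda>n. C * (1/8) ^ n) \<longlonglongrightarrow> 0"
      by (intro tendsto_mult_right_zero LIMSEQ_power_zero) simp
    have "ennreal (\<integral>x. (norm (s n x - g x))\<^sup>2 \<partial>M) \<le> ennreal (C * (1/8) ^ n)" for n
      using Fatou [of n] by (subst (asm) nn_integral_eq_integral) (auto intro: sg)
    then show "\<forall>\<^sub>F n in sequentially. (\<integral>x. (norm (s n x - g x))\<^sup>2 \<partial>M) \<le> C * (1/8) ^ n"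
      using C by (auto intro!: always_eventually simp: ennreal_le_iff)
  qed auto
  ultimately show ?thesis
    using that by blast
qed

text \<open>\<open>G\<close> is not assumed closed, so the projection \<open>m\<close> is returned
  together with a sequence in \<open>G\<close> that tends to it. A minimising sequence is Cauchy by
  the parallelogram law, and orthogonality is the first-order condition at the infimum.\<close>

lemma sq_integrable_projection:
  fixes G :: "('a \<Rightarrow> 'b::euclidean_space) set"
  assumes G: "\<And>m. m \<in> G \<Longrightarrow> sq_integrable M m" "G \<noteq> {}"
    and lin: "\<And>m n c. m \<in> G \<Longrightarrow> n \<in> G \<Longrightarrow> (\<lambda>x. m x + c *\<^sub>R n x) \<in> G"
    and f: "sq_integrable M f"
  obtains s m where "\<And>n. s n \<in> G" "sq_integrable M m"
    "(\<lambda>n. \<integral>x. (norm (s n x - m x))\<^sup>2 \<partial>M) \<longlonglongrightarrow> 0"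
    "\<And>n. n \<in> G \<Longrightarrow> (\<integral>x. inner (n x) (f x - m x) \<partial>M) = 0"
proof -
  define D where "D m = (\<integral>x. (norm (f x - m x))\<^sup>2 \<partial>M)" for m
  define d where "d = Inf (D ` G)"
  have d: "d \<le> D m" if "m \<in> G" for m
    unfolding d_def using that
    by (intro cINF_lower bdd_belowI [where m = 0]) (auto simp: D_def)
  \<comment> \<open>The tolerance decays at the rate that \<open>sq_integrable_complete\<close> asks
    for.\<close>
  define e where "e k = (1/8::real) ^ k" for k :: nat
  have "\<exists>m\<in>G. D m < d + e k" for k
    using cInf_lessD [of "D ` G" "d + e k"] G(2) by (auto simp: d_def e_def)
  then obtain s where s: "\<And>k. s k \<in> G" "\<And>k. D (s k) < d + e k"
    by metis
  have fs: "sq_integrable M (\<lambda>x. f x - s k x)" for k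
    by (intro sq_integrable_diff f G s)
  have "(\<integral>x. (norm (s k x - s n x))\<^sup>2 \<partial>M) \<le> 4 * e n" if "n \<le> k" for n k
  proof -
    define h where "h x = (1/2) *\<^sub>R s k x + (1/2) *\<^sub>R s n x" for x
    \<comment> \<open>The midpoint has to be built from the one closure operation
      \<open>m x + c *\<^sub>R n x\<close>; adding \<open>-1/2\<close> times \<open>s k\<close> to
      \<open>s k\<close> yields its half.\<close>
    have "h = (\<lambda>x. (s k x + (-1/2) *\<^sub>R s k x) + (1/2) *\<^sub>R s n x)"
    proof
      fix x
      have "s k x + (-1/2) *\<^sub>R s k x = (1 + -1/2) *\<^sub>R s k x"
        by (simp only: scaleR_add_left scaleR_one)
      then show "h x = (s k x + (-1/2) *\<^sub>R s k x) + (1/2) *\<^sub>R s n x"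
        by (simp add: h_def)
    qed
    then have h: "h \<in> G"
      using lin [OF lin [OF s(1) [of k] s(1) [of k], of "-1/2"] s(1) [of n], of "1/2"] by simp
    \<comment> \<open>Parallelogram law for \<open>f - s k\<close> and \<open>f - s n\<close>, whose
      mean is \<open>f - h\<close>.\<close>
    have "(norm (s k x - s n x))\<^sup>2 = 2 * (norm (f x - s k x))\<^sup>2 + 2 * (norm (f x - s n x))\<^sup>2
        - 4 * (norm (f x - h x))\<^sup>2" for x
      unfolding h_def
      by (simp add: power2_norm_eq_inner inner_diff inner_add inner_commute algebra_simps)
    then have "(\<integral>x. (norm (s k x - s n x))\<^sup>2 \<partial>M) = 2 * D (s k) + 2 * D (s n) - 4 * D h"
      unfolding D_def
      by (simp add: integrable_norm_power2 fs sq_integrable_diff f G(1) [OF h])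
    also have "\<dots> \<le> 2 * (d + e k) + 2 * (d + e n) - 4 * d"
      using s(2) [of k] s(2) [of n] d [OF h] by (smt (verit))
    also have "\<dots> \<le> 4 * e n"
      using power_decreasing [OF that, of "1/8::real"] unfolding e_def [symmetric] by simp
    finally show ?thesis .
  qed
  then obtain g where g: "sq_integrable M g" "(\<lambda>n. \<integral>x. (norm (s n x - g x))\<^sup>2 \<partial>M) \<longlonglongrightarrow> 0"
    using sq_integrable_complete [of M s 4] G(1) [OF s(1)] unfolding e_def by blast
  have "(\<integral>x. inner (n x) (f x - g x) \<partial>M) = 0" if n: "n \<in> G" for n
  proof -
    define I where "I = (\<integral>x. inner (f x - g x) (n x) \<partial>M)"
    define N where "N = (\<integral>x. (norm (n x))\<^sup>2 \<partial>M)"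
    have lim: "(\<lambda>k. \<integral>x. inner (f x - s k x) (n x) \<partial>M) \<longlonglongrightarrow> I"
      unfolding I_def
    proof (rule tendsto_integral_inner [OF fs _ G(1) [OF n]])
      show "sq_integrable M (\<lambda>x. f x - g x)"
        by (intro sq_integrable_diff f g)
      show "(\<lambda>k. \<integral>x. (norm (f x - s k x - (f x - g x)))\<^sup>2 \<partial>M) \<longlonglongrightarrow> 0"
        using g(2) by (simp add: norm_minus_commute)
    qed
    \<comment> \<open>Moving \<open>s k\<close> by a multiple of \<open>n\<close> stays in
      \<open>G\<close>, so the squared distance cannot fall below \<open>d\<close>, while that of
      \<open>s k\<close> exceeds \<open>d\<close> by less than \<open>e k\<close>. The claim is the
      limit in \<open>k\<close>.\<close>
    have "0 \<le> 0 - 2 * t * I + t\<^sup>2 * N" for t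
    proof -
      have le: "d \<le> D (s k) - 2 * t * (\<integral>x. inner (f x - s k x) (n x) \<partial>M) + t\<^sup>2 * N" for k
        using d [OF lin [OF s(1) [of k] n, of t]]
        unfolding integral_norm_diff_power2 [OF fs G(1) [OF n], symmetric] D_def N_def
        by (simp add: diff_diff_eq)
      have "0 \<le> e k - 2 * t * (\<integral>x. inner (f x - s k x) (n x) \<partial>M) + t\<^sup>2 * N" for k
        using s(2) [of k] le [of k] by linarith
      moreover have "(\<lambda>k. e k - 2 * t * (\<integral>x. inner (f x - s k x) (n x) \<partial>M) + t\<^sup>2 * N)
          \<longlonglongrightarrow> 0 - 2 * t * I + t\<^sup>2 * N"
        by (intro tendsto_intros lim) (simp add: e_def LIMSEQ_power_zero)
      ultimately show ?thesis
        by (meson LIMSEQ_le_const)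
    qed
    then have "I\<^sup>2 \<le> 0 * N"
      by (rule quadratic_nonneg_imp_discriminant) (simp add: N_def)
    then show ?thesis
      by (simp add: I_def inner_commute)
  qed
  then show ?thesis
    using that s(1) g by blast
qed

section \<open>Abstract boundary data spaces\<close>

text \<open>The record offers subtraction but neither addition nor scalar multiplication, so
  linearity is expressed through \<open>sub\<close>. Requiring \<open>ip X u u\<close> to be a
  nonnegative real multiple of one lets a vanishing sum of two such terms split. Completeness enters
  later, through \<open>R_projection\<close>.\<close>

locale inner_product_space =
  fixes X :: "('v, 'k::rc_scalar) ip_space"
  assumes zer_in: "zer X \<in> pts X"
    and sub_in: "u \<in> pts X \<Longrightarrow> v \<in> pts X \<Longrightarrow> sub X u v \<in> pts X"
    and ip_sub: "u \<in> pts X \<Longrightarrow> v \<in> pts X \<Longrightarrow> w \<in> pts X \<Longrightarrow>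
      ip X u (sub X v w) = ip X u v - ip X u w"
    and ip_zer: "u \<in> pts X \<Longrightarrow> ip X u (zer X) = 0"
    and ip_commute: "u \<in> pts X \<Longrightarrow> v \<in> pts X \<Longrightarrow> ip X v u = scalar_cnj (ip X u v)"
    and ip_self: "u \<in> pts X \<Longrightarrow> \<exists>r\<ge>0. ip X u u = r *\<^sub>R 1"
    and ip_self_0: "u \<in> pts X \<Longrightarrow> ip X u u = 0 \<Longrightarrow> u = zer X"
    and sub_eq_zer: "u \<in> pts X \<Longrightarrow> v \<in> pts X \<Longrightarrow> sub X u v = zer X \<longleftrightarrow> u = v"
begin

lemma neg_in: "u \<in> pts X \<Longrightarrow> neg X u \<in> pts X"
  by (simp add: neg_def sub_in zer_in)

lemma ip_neg: "u \<in> pts X \<Longrightarrow> v \<in> pts X \<Longrightarrow> ip X u (neg X v) = - ip X u v"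
  by (simp add: neg_def ip_sub zer_in ip_zer)

lemma zer_ip: "u \<in> pts X \<Longrightarrow> ip X (zer X) u = 0"
  using ip_commute [of u "zer X"] by (simp add: zer_in ip_zer)

lemma sub_ip: "u \<in> pts X \<Longrightarrow> v \<in> pts X \<Longrightarrow> w \<in> pts X \<Longrightarrow>
    ip X (sub X u v) w = ip X u w - ip X v w"
  by (simp add: ip_commute [of w] sub_in ip_sub scalar_cnj_diff)

lemma neg_ip: "u \<in> pts X \<Longrightarrow> v \<in> pts X \<Longrightarrow> ip X (neg X u) v = - ip X u v"
  by (simp add: neg_def sub_ip zer_in zer_ip)

text \<open>Nondegeneracy replaces vector algebra: identities such as \<open>neg_neg\<close> are
  proved by pairing both sides with an arbitrary vector.\<close>

lemma eq_by_ip: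
  assumes "u \<in> pts X" "v \<in> pts X" "\<And>w. w \<in> pts X \<Longrightarrow> ip X w u = ip X w v"
  shows "u = v"
  using assms ip_self_0 [of "sub X u v"] by (simp add: sub_in ip_sub sub_eq_zer)

lemma neg_neg: "u \<in> pts X \<Longrightarrow> neg X (neg X u) = u"
  by (rule eq_by_ip) (simp_all add: neg_in ip_neg)

end

text \<open>
  \<open>T\<close>, \<open>R\<close> and \<open>C\<close> stand for curl on test fields, its closure, and the adjoint of \<open>T\<close>.
  The last assumption is the orthogonal projection of the graph of \<open>C\<close> onto that of \<open>R\<close>.
\<close>

locale adjoint_of_symmetric = inner_product_space X
  for X :: "('v, 'k::rc_scalar) ip_space" +
  fixes T R C :: "('v, 'v) operator"
  assumes C_iff: "(u, v) \<in> C \<longleftrightarrow>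
      u \<in> pts X \<and> v \<in> pts X \<and> (\<forall>(t, t')\<in>T. ip X t' u = ip X t v)"
    and T_subset_R: "T \<subseteq> R"
    and R_subset_C: "R \<subseteq> C"
    and R_C_ip: "(m, m') \<in> R \<Longrightarrow> (u, v) \<in> C \<Longrightarrow> ip X m' u = ip X m v"
    and C_unique: "(u, v) \<in> C \<Longrightarrow> (u, v') \<in> C \<Longrightarrow> v = v'"
    and R_projection: "(u, v) \<in> C \<Longrightarrow>
      \<exists>(m, m')\<in>R. \<forall>(n, n')\<in>R. ip X n (sub X u m) + ip X n' (sub X v m') = 0"
begin

text \<open>\<open>H\<close> to \<open>stacked\<close> repeat the concrete constructions with
  \<open>C\<close> in place of curl, so that unfolding alone identifies them in the final
  proof.\<close>

definition "H = graph_space X X C"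
definition "BD = subspace_of H (orth_compl H (Domain R))"
definition "\<iota>_adj = adjoint_op BD H (Id_on (pts BD))"
definition "bullet = Id_on (pts BD) O C O \<iota>_adj"
definition "stacked = column_op (neg_op X C) \<iota>_adj"

section \<open>Graph space and boundary data\<close>

lemma C_pts: "(u, v) \<in> C \<Longrightarrow> u \<in> pts X" "(u, v) \<in> C \<Longrightarrow> v \<in> pts X"
  by (auto simp: C_iff)

lemma T_pts: "(t, t') \<in> T \<Longrightarrow> t \<in> pts X \<and> t' \<in> pts X"
  using T_subset_R R_subset_C C_pts by blast

lemma C_ip: "(u, v) \<in> C \<Longrightarrow> (t, t') \<in> T \<Longrightarrow> ip X t' u = ip X t v"
  by (auto simp: C_iff)

lemma C_sub: "(u, v) \<in> C \<Longrightarrow> (u', v') \<in> C \<Longrightarrow> (sub X u u', sub X v v') \<in> C"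
  by (subst C_iff) (auto simp: C_pts sub_in ip_sub T_pts C_ip)

lemma C_zer: "(zer X, zer X) \<in> C"
  by (subst C_iff) (auto simp: zer_in ip_zer T_pts)

lemma app_C: "(u, v) \<in> C \<Longrightarrow> app C u = v"
  unfolding app_def using C_unique by blast

lemma pts_H: "pts H = Domain C"
  by (simp add: H_def graph_space_def)

lemma ip_H: "(u, u') \<in> C \<Longrightarrow> (v, v') \<in> C \<Longrightarrow> ip H u v = ip X u v + ip X u' v'"
  by (simp add: H_def graph_space_def app_C)

lemma sub_BD: "sub BD = sub X" and zer_BD: "zer BD = zer X" and ip_BD: "ip BD = ip H"
  by (simp_all add: BD_def H_def graph_space_def subspace_of_def)

text \<open>Graph pairs replace \<open>app\<close>: the witness \<open>v\<close> is the unique image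
  of \<open>u\<close> under \<open>C\<close>, and orthogonality becomes a statement about
  \<open>ip X\<close> alone.\<close>

lemma BD_iff: "u \<in> pts BD \<longleftrightarrow>
    (\<exists>v. (u, v) \<in> C \<and> (\<forall>(m, m')\<in>R. ip X m u + ip X m' v = 0))"
proof
  assume u: "u \<in> pts BD"
  then obtain v where v: "(u, v) \<in> C"
    by (auto simp: BD_def subspace_of_def orth_compl_def pts_H)
  moreover have "ip X m u + ip X m' v = 0" if "(m, m') \<in> R" for m m'
  proof -
    have "ip H m u = 0"
      using u that by (auto simp: BD_def subspace_of_def orth_compl_def)
    then show ?thesis
      using ip_H [OF _ v, of m m'] that R_subset_C by auto
  qed
  ultimately show "\<exists>v. (u, v) \<in> C \<and> (\<forall>(m, m')\<in>R. ip X m u + ip X m' v = 0)"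
    by blast
next
  assume "\<exists>v. (u, v) \<in> C \<and> (\<forall>(m, m')\<in>R. ip X m u + ip X m' v = 0)"
  then obtain v where v: "(u, v) \<in> C" "\<And>m m'. (m, m') \<in> R \<Longrightarrow> ip X m u + ip X m' v = 0"
    by blast
  have "ip H m u = 0" if "(m, m') \<in> R" for m m'
    using ip_H [OF _ v(1), of m m'] v(2) [OF that] that R_subset_C by auto
  then show "u \<in> pts BD"
    using v(1) by (auto simp: BD_def subspace_of_def orth_compl_def pts_H)
qed

lemma BD_zer: "zer X \<in> pts BD"
proof -
  have "ip X m (zer X) + ip X m' (zer X) = 0" if "(m, m') \<in> R" for m m'
    using that R_subset_C C_pts [of m m'] by (auto simp: ip_zer)
  then show ?thesis
    unfolding BD_iff using C_zer by blast
qed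

lemma BD_sub: "u \<in> pts BD \<Longrightarrow> v \<in> pts BD \<Longrightarrow> sub X u v \<in> pts BD"
proof -
  assume "u \<in> pts BD" "v \<in> pts BD"
  then obtain u' v' where u: "(u, u') \<in> C" "\<And>m m'. (m, m') \<in> R \<Longrightarrow> ip X m u + ip X m' u' = 0"
    and v: "(v, v') \<in> C" "\<And>m m'. (m, m') \<in> R \<Longrightarrow> ip X m v + ip X m' v' = 0"
    unfolding BD_iff by blast
  have "ip X m (sub X u v) + ip X m' (sub X u' v') = 0" if "(m, m') \<in> R" for m m'
  proof -
    have "ip X m (sub X u v) + ip X m' (sub X u' v')
        = (ip X m u + ip X m' u') - (ip X m v + ip X m' v')"
      using that R_subset_C C_pts u(1) v(1) by (subst (1 2) ip_sub) auto
    then show ?thesis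
      using u(2) v(2) that by simp
  qed
  then show ?thesis
    unfolding BD_iff using C_sub [OF u(1) v(1)] by blast
qed

text \<open>Boundary data lie in the null space of \<open>1 + C C\<close>. Orthogonality to the
  pairs of \<open>T\<close> reads \<open>ip X t' v = ip X t (neg X u)\<close>, which is the adjoint
  condition for \<open>(v, neg X u)\<close>. Orthogonality of \<open>v\<close> to \<open>R\<close>
  is then the identity \<open>R_C_ip\<close> for \<open>(u, v)\<close>.\<close>

lemma BD_C:
  assumes "u \<in> pts BD" "(u, v) \<in> C"
  shows "(v, neg X u) \<in> C" "v \<in> pts BD"
proof -
  have orth: "ip X m u + ip X m' v = 0" if "(m, m') \<in> R" for m m'
    using assms that C_unique unfolding BD_iff by blast
  have pts: "m \<in> pts X" "m' \<in> pts X" if "(m, m') \<in> R" for m m'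
    using that R_subset_C C_pts by blast+
  note uv = C_pts [OF assms(2)]
  have "ip X t' v = ip X t (neg X u)" if "(t, t') \<in> T" for t t'
    using orth [of t t'] pts [of t t'] that T_subset_R uv
    by (auto simp: ip_neg add_eq_0_iff)
  then show v: "(v, neg X u) \<in> C"
    using uv by (auto simp: C_iff neg_in)
  have "ip X m v + ip X m' (neg X u) = 0" if "(m, m') \<in> R" for m m'
    using R_C_ip [OF that assms(2)] pts [OF that] uv by (simp add: ip_neg)
  then show "v \<in> pts BD"
    unfolding BD_iff using v by blast
qed

lemma ip_H_BD_sub:
  assumes "u \<in> pts BD" "v \<in> Domain C" "w \<in> Domain C"
  shows "ip H u (sub X v w) = ip H u v - ip H u w"
proof -
  obtain u' v' w' where C: "(u, u') \<in> C" "(v, v') \<in> C" "(w, w') \<in> C"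
    using assms by (auto simp: BD_iff)
  show ?thesis
    using C_pts(1) [OF C(1)] C_pts(1) [OF C(2)] C_pts(1) [OF C(3)]
      C_pts(2) [OF C(1)] C_pts(2) [OF C(2)] C_pts(2) [OF C(3)]
    by (simp add: ip_H [OF C(1) C_sub [OF C(2,3)]] ip_H [OF C(1,2)] ip_H [OF C(1,3)] ip_sub)
qed

lemma ip_H_commute:
  assumes "u \<in> Domain C" "v \<in> Domain C"
  shows "ip H v u = scalar_cnj (ip H u v)"
proof -
  obtain u' v' where C: "(u, u') \<in> C" "(v, v') \<in> C"
    using assms by auto
  show ?thesis
    using C_pts(1) [OF C(1)] C_pts(1) [OF C(2)] C_pts(2) [OF C(1)] C_pts(2) [OF C(2)]
    by (simp add: ip_H [OF C(2,1)] ip_H [OF C] scalar_cnj_add ip_commute [of u] ip_commute [of u'])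
qed

lemma ip_H_self_0:
  assumes "u \<in> Domain C" "ip H u u = 0"
  shows "u = zer X"
proof -
  obtain u' where C: "(u, u') \<in> C"
    using assms by auto
  obtain r r' where r: "ip X u u = r *\<^sub>R 1" "0 \<le> r" "ip X u' u' = r' *\<^sub>R 1" "0 \<le> r'"
    using ip_self C_pts [OF C] by blast
  have "(r + r') *\<^sub>R (1::'k) = 0"
    using assms(2) ip_H [OF C C] r by (simp add: scaleR_add_left)
  then have "r = 0"
    using r by simp
  then show ?thesis
    using ip_self_0 r C_pts [OF C] by simp
qed

section \<open>The projection onto the boundary data\<close>

lemma BD_Domain: "u \<in> pts BD \<Longrightarrow> u \<in> Domain C"
  by (auto simp: BD_iff)

text \<open>The adjoint of an embedding is the orthogonal projection, here in relational form. Its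
  values are unique by \<open>\<iota>_adj_unique\<close>, and they exist on the domain of
  \<open>C\<close> by \<open>H_decomposition\<close>.\<close>

lemma \<iota>_adj_iff: "(E, x) \<in> \<iota>_adj \<longleftrightarrow>
    E \<in> Domain C \<and> x \<in> pts BD \<and> (\<forall>u\<in>pts BD. ip H u E = ip H u x)"
  by (auto simp: \<iota>_adj_def adjoint_op_def pts_H ip_BD Id_on_def)

lemma \<iota>_adj_unique: "(E, x) \<in> \<iota>_adj \<Longrightarrow> (E, y) \<in> \<iota>_adj \<Longrightarrow> x = y"
proof -
  assume "(E, x) \<in> \<iota>_adj" "(E, y) \<in> \<iota>_adj"
  then have xy: "x \<in> pts BD" "y \<in> pts BD" "\<And>u. u \<in> pts BD \<Longrightarrow> ip H u x = ip H u y"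
    unfolding \<iota>_adj_iff by force+
  then have "sub X x y = zer X"
    by (intro ip_H_self_0) (auto simp: ip_H_BD_sub BD_sub BD_Domain)
  then show ?thesis
    using xy by (metis BD_Domain C_pts(1) DomainE sub_eq_zer)
qed

lemma app_\<iota>_adj: "(E, x) \<in> \<iota>_adj \<Longrightarrow> app \<iota>_adj E = x"
  unfolding app_def using \<iota>_adj_unique by blast

lemma \<iota>_adj_BD: "u \<in> pts BD \<Longrightarrow> (u, u) \<in> \<iota>_adj"
  by (simp add: \<iota>_adj_iff BD_Domain)

text \<open>Subtracting the projection onto \<open>R\<close> leaves a boundary datum. The removed
  part is orthogonal to all boundary data, so the remainder is also the value of
  \<open>\<iota>_adj\<close>.\<close>

lemma H_decomposition:
  assumes "(u, v) \<in> C"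
  obtains m m' where "(m, m') \<in> R" "(u, sub X u m) \<in> \<iota>_adj"
proof -
  obtain m m' where m: "(m, m') \<in> R"
    and orth: "\<And>n n'. (n, n') \<in> R \<Longrightarrow> ip X n (sub X u m) + ip X n' (sub X v m') = 0"
    using R_projection [OF assms] by fastforce
  have mC: "(m, m') \<in> C"
    using m R_subset_C by auto
  have BD: "sub X u m \<in> pts BD"
    unfolding BD_iff using C_sub [OF assms mC] orth by blast
  have "ip H w u = ip H w (sub X u m)" if w: "w \<in> pts BD" for w
  proof -
    have "ip H m w = 0"
      using w m by (auto simp: BD_def subspace_of_def orth_compl_def)
    then have "ip H w m = 0"
      using ip_H_commute [OF DomainI BD_Domain, OF mC w] by simp
    then show ?thesis
      using ip_H_BD_sub [OF w DomainI DomainI, OF assms mC] by simp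
  qed
  then have "(u, sub X u m) \<in> \<iota>_adj"
    using BD assms by (auto simp: \<iota>_adj_iff)
  with m that show ?thesis
    by blast
qed

text \<open>The remainder of \<open>w\<close> after removing its part in \<open>R\<close> is a
  boundary datum whose product with itself equals its product with \<open>w\<close>, hence is
  zero.\<close>

lemma orthogonal_BD_imp_R:
  assumes "(w, v) \<in> C" "\<And>u. u \<in> pts BD \<Longrightarrow> ip H u w = 0"
  shows "(w, v) \<in> R"
proof -
  obtain m m' where m: "(m, m') \<in> R" "(w, sub X w m) \<in> \<iota>_adj"
    using H_decomposition [OF assms(1)] by blast
  then have "ip H (sub X w m) (sub X w m) = ip H (sub X w m) w" "sub X w m \<in> pts BD"
    unfolding \<iota>_adj_iff by auto
  then have "sub X w m = zer X"
    using ip_H_self_0 assms(2) BD_Domain by metis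
  then have "w = m"
    using m(1) R_subset_C C_pts(1) assms(1) sub_eq_zer by blast
  then show ?thesis
    using m(1) R_subset_C C_unique assms(1) by blast
qed

lemma ip_\<iota>_adj:
  assumes "(E, x) \<in> \<iota>_adj" "\<eta> \<in> pts BD"
  shows "ip H x \<eta> = ip H E \<eta>"
  using assms ip_H_commute [of \<eta> x] ip_H_commute [of \<eta> E] by (auto simp: \<iota>_adj_iff BD_Domain)

text \<open>The image of a boundary datum is again one by \<open>BD_C\<close>, and the projection
  fixes it.\<close>

lemma app_bullet:
  assumes "\<eta> \<in> pts BD" "(\<eta>, y) \<in> C"
  shows "app bullet \<eta> = y"
proof -
  have "(\<eta>, z) \<in> bullet \<longleftrightarrow> z = y" for z
    using assms C_unique \<iota>_adj_unique \<iota>_adj_BD [OF BD_C(2) [OF assms]]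
    unfolding bullet_def by blast
  then show ?thesis
    by (simp add: app_def)
qed

text \<open>Trades the equation between values of \<open>app\<close> for a relational statement: the
  projection of \<open>F\<close>, which exists by \<open>H_decomposition\<close>, is the image of
  \<open>\<eta>\<close>.\<close>

lemma sub_eq_zer_iff_\<iota>_adj:
  assumes "(F, F') \<in> C" "\<eta> \<in> pts BD" "(\<eta>, y) \<in> C"
  shows "sub BD (app \<iota>_adj F) (app bullet \<eta>) = zer BD \<longleftrightarrow> (F, y) \<in> \<iota>_adj"
proof -
  obtain p where p: "(F, p) \<in> \<iota>_adj"
    using H_decomposition [OF assms(1)] by blast
  then have "p \<in> pts X"
    using BD_Domain C_pts(1) unfolding \<iota>_adj_iff by blast
  then have "sub BD (app \<iota>_adj F) (app bullet \<eta>) = zer BD \<longleftrightarrow> p = y"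
    using C_pts(2) [OF assms(3)]
    by (simp add: app_\<iota>_adj [OF p] app_bullet [OF assms(2,3)] sub_BD zer_BD sub_eq_zer)
  then show ?thesis
    using p \<iota>_adj_unique by blast
qed

section \<open>The adjoint of the stacked operator\<close>

lemma stacked_iff: "(E, (G, x)) \<in> stacked \<longleftrightarrow>
    (\<exists>E'. (E, E') \<in> C \<and> G = neg X E') \<and> (E, x) \<in> \<iota>_adj"
  by (auto simp: stacked_def column_op_def neg_op_def)

lemma stacked_adjoint_iff:
  "((F, \<eta>), x) \<in> adjoint_op X (direct_sum X BD) stacked \<longleftrightarrow>
    F \<in> pts X \<and> \<eta> \<in> pts BD \<and> x \<in> pts X \<and>
    (\<forall>E E' z. (E, E') \<in> C \<longrightarrow> (E, z) \<in> \<iota>_adj \<longrightarrow>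
      ip X (neg X E') F + ip H z \<eta> = ip X E x)"
  by (simp add: adjoint_op_def direct_sum_def Ball_def split_paired_All stacked_iff ip_BD) blast

lemma stacked_adjoint_imp:
  assumes "((F, \<eta>), x) \<in> adjoint_op X (direct_sum X BD) stacked"
  obtains y where "(F, neg X x) \<in> C" "x \<in> pts X" "\<eta> \<in> pts BD" "(\<eta>, y) \<in> C" "(F, y) \<in> \<iota>_adj"
proof -
  have pts: "F \<in> pts X" "\<eta> \<in> pts BD" "x \<in> pts X"
    and eq: "\<And>E E' z. (E, E') \<in> C \<Longrightarrow> (E, z) \<in> \<iota>_adj \<Longrightarrow>
      ip X (neg X E') F + ip H z \<eta> = ip X E x"
    using assms unfolding stacked_adjoint_iff by blast+
  obtain y where y: "(\<eta>, y) \<in> C"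
    using BD_Domain pts by blast
  have "ip X t' F = ip X t (neg X x)" if t: "(t, t') \<in> T" for t t'
  proof -
    have tC: "(t, t') \<in> C" and tR: "(t, t') \<in> R"
      using t T_subset_R R_subset_C by auto
    \<comment> \<open>Boundary data are orthogonal to \<open>R\<close>, so zero is the projection of
      \<open>t\<close> and the boundary term drops out of the adjoint relation.\<close>
    have "ip H u t = ip H u (zer X)" if u: "u \<in> pts BD" for u
    proof -
      obtain u' where u': "(u, u') \<in> C" "ip X t u + ip X t' u' = 0"
        using u tR unfolding BD_iff by blast
      then have "ip H t u = 0"
        by (simp add: ip_H [OF tC])
      then have "ip H u t = 0"
        using ip_H_commute [of t u] u' tC by (metis DomainI scalar_cnj_0)
      then show ?thesis
        using ip_H [OF u'(1) C_zer] C_pts [OF u'(1)] by (simp add: ip_zer)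
    qed
    then have "(t, zer X) \<in> \<iota>_adj"
      using tC BD_zer by (auto simp: \<iota>_adj_iff)
    moreover have "ip H (zer X) \<eta> = 0"
      using ip_H [OF C_zer y] C_pts [OF y] by (simp add: zer_ip)
    ultimately have "ip X (neg X t') F = ip X t x"
      using eq [OF tC, of "zer X"] by simp
    then show ?thesis
      using C_pts [OF tC] pts by (metis neg_ip ip_neg minus_minus)
  qed
  then have FC: "(F, neg X x) \<in> C"
    using pts by (auto simp: C_iff neg_in)
  have "ip H u F = ip H u y" if u: "u \<in> pts BD" for u
  proof -
    obtain v where v: "(u, v) \<in> C"
      using u BD_Domain by blast
    note vC = BD_C [OF u v]
    \<comment> \<open>Insert the pair \<open>(v, neg X u)\<close>, whose first entry is its own
      projection. Since \<open>\<eta>\<close> has image \<open>y\<close> and \<open>y\<close> has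
      image \<open>neg X \<eta>\<close>, the terms regroup into the graph products of
      \<open>u\<close> with \<open>F\<close> and with \<open>y\<close>.\<close>
    have "ip X (neg X (neg X u)) F + ip H v \<eta> = ip X v x"
      by (rule eq [OF vC(1) \<iota>_adj_BD [OF vC(2)]])
    then have "ip X u F + (ip X v \<eta> - ip X u y) = ip X v x"
      using C_pts [OF v] C_pts [OF y] by (simp add: neg_neg neg_ip ip_H [OF vC(1) y])
    then show ?thesis
      using C_pts [OF v] C_pts [OF y] pts
      by (simp add: ip_H [OF v FC] ip_H [OF v BD_C(1) [OF pts(2) y]] ip_neg algebra_simps)
  qed
  then have "(F, y) \<in> \<iota>_adj"
    using FC BD_C(2) [OF pts(2) y] by (auto simp: \<iota>_adj_iff)
  then show ?thesis
    using that FC pts y by blast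
qed

lemma stacked_adjointI:
  assumes F: "(F, F') \<in> C" and \<eta>: "\<eta> \<in> pts BD" "(\<eta>, y) \<in> C" and Fy: "(F, y) \<in> \<iota>_adj"
  shows "((F, \<eta>), neg X F') \<in> adjoint_op X (direct_sum X BD) stacked"
  unfolding stacked_adjoint_iff
proof (intro conjI allI impI)
  note yC = BD_C [OF \<eta>]
  show "F \<in> pts X" "\<eta> \<in> pts BD" "neg X F' \<in> pts X"
    using \<eta> C_pts [OF F] neg_in by auto
  \<comment> \<open>The image of \<open>y\<close> is \<open>neg X \<eta>\<close>, so
    \<open>w'\<close> is the image of \<open>w\<close>; it stands for \<open>F' + \<eta>\<close>,
    written as a difference because the record has no addition.\<close>
  define w w' where "w = sub X F y" and "w' = sub X F' (neg X \<eta>)"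
  have "(w, w') \<in> R"
  proof (rule orthogonal_BD_imp_R)
    show "(w, w') \<in> C"
      unfolding w_def w'_def by (rule C_sub [OF F yC(1)])
    show "ip H u w = 0" if "u \<in> pts BD" for u
      unfolding w_def using that Fy F BD_Domain yC(2)
      by (subst ip_H_BD_sub) (auto simp: \<iota>_adj_iff)
  qed
  fix E E' z
  assume E: "(E, E') \<in> C" and z: "(E, z) \<in> \<iota>_adj"
  note pts = C_pts [OF E] C_pts [OF F] C_pts [OF \<eta>(2)]
  have "ip X w' E = ip X w E'"
    by (rule R_C_ip [OF \<open>(w, w') \<in> R\<close> E])
  \<comment> \<open>Conjugate symmetry brings \<open>E\<close> and \<open>E'\<close> into the first
    slot, where the adjoint relation has them.\<close>
  then have "ip X E w' = ip X E' w"
    using pts by (simp add: ip_commute [of _ E] ip_commute [of _ E'] ip_commute [of w]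
      ip_commute [of w'] w_def w'_def sub_in neg_in)
  then have "ip X E F' + ip X E \<eta> = ip X E' F - ip X E' y"
    using pts by (simp add: w_def w'_def ip_sub neg_in ip_neg)
  \<comment> \<open>Against the boundary datum \<open>\<eta>\<close> the projection \<open>z\<close>
    may be replaced by \<open>E\<close>, so the boundary term expands to
    \<open>ip X E \<eta> + ip X E' y\<close>.\<close>
  then show "ip X (neg X E') F + ip H z \<eta> = ip X E (neg X F')"
    using pts by (simp add: ip_\<iota>_adj [OF z \<eta>(1)] ip_H [OF E \<eta>(2)] neg_ip ip_neg algebra_simps)
qed

theorem adjoint_stacked:
  "adjoint_op X (direct_sum X BD) stacked \<subseteq>
    {((E, \<eta>), F) | E \<eta> F. (E, F) \<in> neg_op X C \<and> \<eta> \<in> pts BD}"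
  "Domain (adjoint_op X (direct_sum X BD) stacked) =
    {(E, \<eta>). E \<in> Domain C \<and> \<eta> \<in> pts BD \<and>
      sub BD (app \<iota>_adj E) (app bullet \<eta>) = zer BD}"
proof -
  show "adjoint_op X (direct_sum X BD) stacked \<subseteq>
      {((E, \<eta>), F) | E \<eta> F. (E, F) \<in> neg_op X C \<and> \<eta> \<in> pts BD}"
  proof clarify
    fix F \<eta> x
    assume "((F, \<eta>), x) \<in> adjoint_op X (direct_sum X BD) stacked"
    then obtain y where "(F, neg X x) \<in> C" "x \<in> pts X" "\<eta> \<in> pts BD"
      by (rule stacked_adjoint_imp)
    then show "\<exists>E \<eta>' F'. ((F, \<eta>), x) = ((E, \<eta>'), F') \<and> (E, F') \<in> neg_op X C \<and> \<eta>' \<in> pts BD"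
      using neg_neg [of x] by (auto simp: neg_op_def) metis
  qed
  have "(F, \<eta>) \<in> Domain (adjoint_op X (direct_sum X BD) stacked) \<longleftrightarrow>
      F \<in> Domain C \<and> \<eta> \<in> pts BD \<and> sub BD (app \<iota>_adj F) (app bullet \<eta>) = zer BD" for F \<eta>
  proof
    assume "(F, \<eta>) \<in> Domain (adjoint_op X (direct_sum X BD) stacked)"
    then obtain x where "((F, \<eta>), x) \<in> adjoint_op X (direct_sum X BD) stacked"
      by blast
    then obtain y where "(F, neg X x) \<in> C" "\<eta> \<in> pts BD" "(\<eta>, y) \<in> C" "(F, y) \<in> \<iota>_adj"
      by (rule stacked_adjoint_imp)
    then show "F \<in> Domain C \<and> \<eta> \<in> pts BD \<and> sub BD (app \<iota>_adj F) (app bullet \<eta>) = zer BD"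
      using sub_eq_zer_iff_\<iota>_adj by blast
  next
    assume asm: "F \<in> Domain C \<and> \<eta> \<in> pts BD \<and> sub BD (app \<iota>_adj F) (app bullet \<eta>) = zer BD"
    then obtain F' y where "(F, F') \<in> C" "(\<eta>, y) \<in> C"
      using BD_Domain by blast
    then show "(F, \<eta>) \<in> Domain (adjoint_op X (direct_sum X BD) stacked)"
      using asm stacked_adjointI sub_eq_zer_iff_\<iota>_adj by blast
  qed
  then show "Domain (adjoint_op X (direct_sum X BD) stacked) =
    {(E, \<eta>). E \<in> Domain C \<and> \<eta> \<in> pts BD \<and>
      sub BD (app \<iota>_adj E) (app bullet \<eta>) = zer BD}"
    by (simp only: set_eq_iff split_paired_All mem_Collect_eq case_prod_conv simp_thms)
qed

end

section \<open>The Hilbert space of vector fields\<close>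

lemma square_integrable_iff: "f \<in> square_integrable \<Omega> \<longleftrightarrow> sq_integrable (lebesgue_on \<Omega>) f"
  by (simp add: square_integrable_def sq_integrable_def)

lemma ae_class_eq_iff:
  assumes "f \<in> square_integrable \<Omega>" "g \<in> square_integrable \<Omega>"
  shows "ae_class \<Omega> f = ae_class \<Omega> g \<longleftrightarrow> (AE x in lebesgue_on \<Omega>. f x = g x)"
proof
  assume "ae_class \<Omega> f = ae_class \<Omega> g"
  moreover have "f \<in> ae_class \<Omega> f"
    using assms by (simp add: ae_class_def)
  ultimately show "AE x in lebesgue_on \<Omega>. f x = g x"
    by (simp add: ae_class_def)
next
  assume eq: "AE x in lebesgue_on \<Omega>. f x = g x"
  have "(AE x in lebesgue_on \<Omega>. h x = f x) \<longleftrightarrow> (AE x in lebesgue_on \<Omega>. h x = g x)" for h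
  proof
    show "AE x in lebesgue_on \<Omega>. h x = g x" if "AE x in lebesgue_on \<Omega>. h x = f x"
      using that eq by eventually_elim simp
    show "AE x in lebesgue_on \<Omega>. h x = f x" if "AE x in lebesgue_on \<Omega>. h x = g x"
      using that eq by eventually_elim simp
  qed
  then show "ae_class \<Omega> f = ae_class \<Omega> g"
    by (simp add: ae_class_def)
qed

lemma rep_ae_class:
  assumes "f \<in> square_integrable \<Omega>"
  shows "rep (ae_class \<Omega> f) \<in> square_integrable \<Omega>"
    and "AE x in lebesgue_on \<Omega>. rep (ae_class \<Omega> f) x = f x"
proof -
  have "f \<in> ae_class \<Omega> f"
    using assms by (simp add: ae_class_def)
  then have "rep (ae_class \<Omega> f) \<in> ae_class \<Omega> f"
    unfolding rep_def by (rule someI [of "\<lambda>g. g \<in> ae_class \<Omega> f"])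
  then show "rep (ae_class \<Omega> f) \<in> square_integrable \<Omega>"
    and "AE x in lebesgue_on \<Omega>. rep (ae_class \<Omega> f) x = f x"
    by (auto simp: ae_class_def)
qed

lemma pts_L2_iff: "U \<in> pts (L2 \<Omega>) \<longleftrightarrow> (\<exists>f\<in>square_integrable \<Omega>. U = ae_class \<Omega> f)"
  by (auto simp: L2_def)

lemma ae_class_in_L2: "f \<in> square_integrable \<Omega> \<Longrightarrow> ae_class \<Omega> f \<in> pts (L2 \<Omega>)"
  by (auto simp: L2_def)

lemma borel_measurable_vdot [measurable]:
  fixes f g :: "'a \<Rightarrow> 'k::rc_scalar^'n"
  assumes [measurable]: "f \<in> borel_measurable M" "g \<in> borel_measurable M"
  shows "(\<lambda>x. vdot (f x) (g x)) \<in> borel_measurable M"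
proof (rule borel_measurable_continuous_Pair [where H = vdot])
  show "continuous_on UNIV (\<lambda>x::('k^'n) \<times> ('k^'n). vdot (fst x) (snd x))"
    unfolding vdot_def
    by (intro continuous_intros bounded_linear.continuous_on [OF bounded_linear_scalar_cnj])
qed measurable

lemma integrable_vdot:
  assumes [measurable]: "sq_integrable M f" "sq_integrable M g"
  shows "integrable M (\<lambda>x. vdot (f x) (g x))"
  by (rule sq_integrable_integrable_bound [OF assms]) (auto simp: norm_vdot_le)

text \<open>\<open>rep\<close> picks an arbitrary member of a class and integrals do not see that
  choice. Together with \<open>sub_L2\<close> this allows computing with explicit functions.\<close>

lemma ip_L2:
  assumes f: "f \<in> square_integrable \<Omega>" and g: "g \<in> square_integrable \<Omega>"
  shows "ip (L2 \<Omega>) (ae_class \<Omega> f) (ae_class \<Omega> g) = (\<integral>x. vdot (f x) (g x) \<partial>lebesgue_on \<Omega>)"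
proof -
  have [measurable]: "f \<in> borel_measurable (lebesgue_on \<Omega>)" "g \<in> borel_measurable (lebesgue_on \<Omega>)"
    "rep (ae_class \<Omega> f) \<in> borel_measurable (lebesgue_on \<Omega>)"
    "rep (ae_class \<Omega> g) \<in> borel_measurable (lebesgue_on \<Omega>)"
    using f g rep_ae_class(1) [OF f] rep_ae_class(1) [OF g] by (auto simp: square_integrable_def)
  have "(\<integral>x. vdot (rep (ae_class \<Omega> f) x) (rep (ae_class \<Omega> g) x) \<partial>lebesgue_on \<Omega>)
      = (\<integral>x. vdot (f x) (g x) \<partial>lebesgue_on \<Omega>)"
  proof (rule integral_cong_AE)
    show "AE x in lebesgue_on \<Omega>.
        vdot (rep (ae_class \<Omega> f) x) (rep (ae_class \<Omega> g) x) = vdot (f x) (g x)"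
      using rep_ae_class(2) [OF f] rep_ae_class(2) [OF g] by eventually_elim simp
  qed measurable
  then show ?thesis
    by (simp add: L2_def vdot_def)
qed

lemma sub_L2:
  assumes f: "f \<in> square_integrable \<Omega>" and g: "g \<in> square_integrable \<Omega>"
  shows "sub (L2 \<Omega>) (ae_class \<Omega> f) (ae_class \<Omega> g) = ae_class \<Omega> (\<lambda>x. f x - g x)"
proof -
  have "AE x in lebesgue_on \<Omega>. rep (ae_class \<Omega> f) x - rep (ae_class \<Omega> g) x = f x - g x"
    using rep_ae_class(2) [OF f] rep_ae_class(2) [OF g] by eventually_elim simp
  then show ?thesis
    using f g rep_ae_class(1) [OF f] rep_ae_class(1) [OF g]
    by (simp add: L2_def ae_class_eq_iff square_integrable_iff sq_integrable_diff)
qed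

lemma ip_L2_self:
  assumes "f \<in> square_integrable \<Omega>"
  shows "ip (L2 \<Omega>) (ae_class \<Omega> f) (ae_class \<Omega> f) = (\<integral>x. (norm (f x))\<^sup>2 \<partial>lebesgue_on \<Omega>) *\<^sub>R 1"
  using assms by (simp add: ip_L2 vdot_self square_integrable_iff integrable_norm_power2)

lemma zer_L2: "zer (L2 \<Omega>) = ae_class \<Omega> (\<lambda>x. 0)"
  by (simp add: L2_def)

interpretation L2: inner_product_space "L2 \<Omega> :: (('k::rc_scalar) vfield set, 'k) ip_space"
proof
  have z: "(\<lambda>x. 0) \<in> (square_integrable \<Omega> :: 'k vfield set)"
    by (simp add: square_integrable_iff sq_integrable_zero)
  show "zer (L2 \<Omega> :: ('k vfield set, 'k) ip_space) \<in> pts (L2 \<Omega>)"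
    using z by (auto simp: zer_L2 pts_L2_iff)
  fix U V W :: "'k vfield set"
  assume "U \<in> pts (L2 \<Omega>)"
  then obtain u where u: "u \<in> square_integrable \<Omega>" "U = ae_class \<Omega> u"
    by (auto simp: pts_L2_iff)
  show "ip (L2 \<Omega>) U (zer (L2 \<Omega>)) = 0"
    using u z by (simp add: zer_L2 ip_L2) (simp add: vdot_def)
  show "\<exists>r\<ge>0. ip (L2 \<Omega>) U U = r *\<^sub>R 1"
    using u by (auto simp: ip_L2_self)
  show "U = zer (L2 \<Omega>)" if "ip (L2 \<Omega>) U U = 0"
  proof -
    have "(\<integral>x. (norm (u x))\<^sup>2 \<partial>lebesgue_on \<Omega>) = 0"
      using that u by (simp add: ip_L2_self)
    then have "AE x in lebesgue_on \<Omega>. (norm (u x))\<^sup>2 = 0"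
      using u by (subst (asm) integral_nonneg_eq_0_iff_AE) (auto simp: square_integrable_def)
    then show ?thesis
      using u z by (simp add: zer_L2 ae_class_eq_iff)
  qed
  assume "V \<in> pts (L2 \<Omega>)"
  then obtain v where v: "v \<in> square_integrable \<Omega>" "V = ae_class \<Omega> v"
    by (auto simp: pts_L2_iff)
  have uv: "(\<lambda>x. u x - v x) \<in> square_integrable \<Omega>"
    using u v by (simp add: square_integrable_iff sq_integrable_diff)
  then show "sub (L2 \<Omega>) U V \<in> pts (L2 \<Omega>)"
    using u v by (auto simp: sub_L2 pts_L2_iff)
  show "ip (L2 \<Omega>) V U = scalar_cnj (ip (L2 \<Omega>) U V)"
    using u v integral_bounded_linear [OF bounded_linear_scalar_cnj integrable_vdot, of "lebesgue_on \<Omega>" u v]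
    by (simp add: ip_L2 vdot_commute [of "v _"] square_integrable_iff)
  show "sub (L2 \<Omega>) U V = zer (L2 \<Omega>) \<longleftrightarrow> U = V"
    using u v z uv by (simp add: sub_L2 zer_L2 ae_class_eq_iff)
  assume "W \<in> pts (L2 \<Omega>)"
  then obtain w where w: "w \<in> square_integrable \<Omega>" "W = ae_class \<Omega> w"
    by (auto simp: pts_L2_iff)
  have "(\<lambda>x. v x - w x) \<in> square_integrable \<Omega>"
    using w v by (simp add: square_integrable_iff sq_integrable_diff)
  then show "ip (L2 \<Omega>) U (sub (L2 \<Omega>) V W) = ip (L2 \<Omega>) U V - ip (L2 \<Omega>) U W"
    using u v w by (simp add: sub_L2 ip_L2 vdot_diff_right integrable_vdot square_integrable_iff)
qed

section \<open>Smooth functions\<close>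

lemma partial_deriv_eq: "(f has_derivative f') (at x) \<Longrightarrow> partial_deriv i f x = f' (axis i 1)"
  unfolding partial_deriv_def using frechet_derivative_at by metis

lemma differentiable_has_derivative:
  "f differentiable at x \<Longrightarrow> (f has_derivative frechet_derivative f (at x)) (at x)"
  using frechet_derivative_works by blast

text \<open>The successor clause of \<open>C_k\<close> speaks of differentiability, so in the base
  case continuity has to be recovered from it.\<close>

lemma C_k_SucD: "C_k (Suc k) f \<Longrightarrow> C_k k f"
proof (induction k arbitrary: f)
  case 0
  then have "\<forall>x. f differentiable at x"
    by simp
  then show ?case
    by (simp add: continuous_at_imp_continuous_on differentiable_imp_continuous_within)
next
  case (Suc k)
  then show ?case
    by simp
qed

lemma C_k_continuous: "C_k k f \<Longrightarrow> continuous_on UNIV f"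
  by (induction k) (use C_k_SucD in \<open>force+\<close>)

lemma partial_deriv_bounded_linear:
  assumes "bounded_linear L" "f differentiable at x"
  shows "partial_deriv i (\<lambda>x. L (f x)) x = L (partial_deriv i f x)"
  using partial_deriv_eq [OF bounded_linear.has_derivative [OF assms(1)
      differentiable_has_derivative [OF assms(2)]]]
  by (simp add: partial_deriv_def)

lemma C_k_bounded_linear:
  assumes L: "bounded_linear L"
  shows "C_k k f \<Longrightarrow> C_k k (\<lambda>x. L (f x))"
proof (induction k arbitrary: f)
  case 0
  then show ?case
    using bounded_linear.continuous_on [OF L] by simp
next
  case (Suc k)
  then have "partial_deriv i (\<lambda>x. L (f x)) = (\<lambda>x. L (partial_deriv i f x))" for i
    using partial_deriv_bounded_linear [OF L, of f] by (intro ext) simp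
  moreover have "(\<lambda>x. L (f x)) differentiable at x" for x
    using Suc.prems bounded_linear.has_derivative [OF L] unfolding differentiable_def C_k.simps
    by blast
  ultimately show ?case
    using Suc by simp
qed

lemma partial_deriv_add:
  assumes "f differentiable at x" "g differentiable at x"
  shows "partial_deriv i (\<lambda>x. f x + g x) x = partial_deriv i f x + partial_deriv i g x"
  using partial_deriv_eq [OF has_derivative_add [OF assms [THEN differentiable_has_derivative]]]
  by (simp add: partial_deriv_def)

lemma C_k_add: "C_k k f \<Longrightarrow> C_k k g \<Longrightarrow> C_k k (\<lambda>x. f x + g x)"
proof (induction k arbitrary: f g)
  case 0
  then show ?case
    by (simp add: continuous_on_add)
next
  case (Suc k)
  then have "partial_deriv i (\<lambda>x. f x + g x) = (\<lambda>x. partial_deriv i f x + partial_deriv i g x)" for i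
    using partial_deriv_add [of f _ g] by (intro ext) simp
  with Suc show ?case
    by simp
qed

lemma partial_deriv_mult:
  fixes f g :: "real^3 \<Rightarrow> 'a::real_normed_field"
  assumes "f differentiable at x" "g differentiable at x"
  shows "partial_deriv i (\<lambda>x. f x * g x) x = f x * partial_deriv i g x + partial_deriv i f x * g x"
  using partial_deriv_eq [OF has_derivative_mult [OF assms [THEN differentiable_has_derivative]]]
  by (simp add: partial_deriv_def)

lemma C_k_mult:
  fixes f g :: "real^3 \<Rightarrow> 'a::real_normed_field"
  shows "C_k k f \<Longrightarrow> C_k k g \<Longrightarrow> C_k k (\<lambda>x. f x * g x)"
proof (induction k arbitrary: f g)
  case 0
  then show ?case
    by (simp add: continuous_on_mult)
next
  case (Suc k)
  then have "partial_deriv i (\<lambda>x. f x * g x)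
      = (\<lambda>x. f x * partial_deriv i g x + partial_deriv i f x * g x)" for i
    using partial_deriv_mult [of f _ g] by (intro ext) simp
  \<comment> \<open>The product rule contains the undifferentiated factors, whose order has to be
    lowered from \<open>Suc k\<close> to \<open>k\<close> before the induction hypothesis
    applies.\<close>
  moreover have "C_k k (\<lambda>x. f x * partial_deriv i g x + partial_deriv i f x * g x)" for i
    using Suc.prems C_k_SucD [OF Suc.prems(1)] C_k_SucD [OF Suc.prems(2)]
    by (intro C_k_add Suc.IH) auto
  ultimately show ?case
    using Suc.prems by simp
qed

lemma partial_deriv_const: "partial_deriv i (\<lambda>x. c) = (\<lambda>x. 0)"
  by (rule ext) (rule partial_deriv_eq [OF has_derivative_const])

lemma C_k_const: "C_k k (\<lambda>x. c)"
  by (induction k arbitrary: c) (simp_all add: partial_deriv_const)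

lemma C_k_prod:
  fixes f :: "'b \<Rightarrow> real^3 \<Rightarrow> 'a::real_normed_field"
  assumes "finite A" "\<And>a. a \<in> A \<Longrightarrow> C_k k (f a)"
  shows "C_k k (\<lambda>x. \<Prod>a\<in>A. f a x)"
  using assms by (induction A) (simp_all add: C_k_const C_k_mult)

text \<open>The polynomials make the family closed under differentiation.\<close>

definition flat :: "real poly \<Rightarrow> real \<Rightarrow> real" where
  "flat p t = (if t > 0 then poly p (1/t) * exp (- (1/t)) else 0)"

lemma tendsto_poly_div_exp: "((\<lambda>x::real. poly p x * exp (- x)) \<longlongrightarrow> 0) at_top"
proof -
  have "((\<lambda>x. \<Sum>i\<le>degree p. coeff p i * (x ^ i / exp x)) \<longlongrightarrow> (\<Sum>i\<le>degree p. coeff p i * 0)) at_top"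
    by (intro tendsto_intros tendsto_power_div_exp_0)
  then show ?thesis
    by (simp add: poly_altdef exp_minus divide_inverse sum_distrib_right mult.assoc)
qed

text \<open>Taking reciprocals turns the right-hand limit at zero into the decay of a polynomial
  times \<open>exp (- x)\<close> at infinity; on the left \<open>flat p\<close> vanishes.\<close>

lemma flat_tendsto_0: "(flat p \<longlongrightarrow> 0) (at 0)"
proof -
  have "((\<lambda>t. poly p (inverse t) * exp (- inverse t)) \<longlongrightarrow> 0) (at_right 0)"
    by (rule filterlim_compose [OF tendsto_poly_div_exp filterlim_inverse_at_top_right])
  then have "(flat p \<longlongrightarrow> 0) (at_right 0)"
    by (rule Lim_transform_eventually)
      (auto simp: flat_def divide_inverse eventually_at_filter)
  moreover have "(flat p \<longlongrightarrow> 0) (at_left 0)"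
    by (rule Lim_transform_eventually [OF tendsto_const])
      (auto simp: flat_def eventually_at_filter)
  ultimately show ?thesis
    by (simp add: filterlim_split_at)
qed

text \<open>For positive \<open>t\<close> the derivative of \<open>p(1/t) exp(-1/t)\<close> is
  \<open>(p - p')(1/t) exp(-1/t) / t^2\<close>, and dividing by \<open>t^2\<close> is multiplying by
  the monomial \<open>[:0, 0, 1:]\<close> evaluated at \<open>1/t\<close>.\<close>

lemma flat_has_derivative:
  "(flat p has_real_derivative flat ([:0, 0, 1:] * (p - pderiv p)) t) (at t)"
proof (cases t "0::real" rule: linorder_cases)
  case less
  have "((\<lambda>t. 0) has_real_derivative 0) (at t)"
    by simp
  then show ?thesis
    by (rule has_field_derivative_transform_within_open [where S = "{..<0}", THEN DERIV_cong])
      (use less in \<open>auto simp: flat_def\<close>)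
next
  case equal
  have "((\<lambda>h. flat ([:0, 1:] * p) h) \<longlongrightarrow> 0) (at 0)"
    by (rule flat_tendsto_0)
  \<comment> \<open>Dividing by \<open>h\<close> multiplies the polynomial by its variable, so the
    difference quotient at zero stays in the family and tends to zero.\<close>
  moreover have "(flat p (0 + h) - flat p 0) / h = flat ([:0, 1:] * p) h" for h
    by (simp add: flat_def)
  ultimately show ?thesis
    using equal by (simp add: DERIV_def flat_def [of _ 0])
next
  case greater
  have "((\<lambda>t. poly p (1/t) * exp (- (1/t))) has_real_derivative
      flat ([:0, 0, 1:] * (p - pderiv p)) t) (at t)"
    using greater
    by (auto intro!: derivative_eq_intros DERIV_chain2 [OF poly_DERIV]
        simp: flat_def field_simps power2_eq_square)
  then show ?thesis
    by (rule has_field_derivative_transform_within_open [where S = "{0<..}"])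
      (use greater in \<open>auto simp: flat_def\<close>)
qed

lemma C_k_flat: "C_k k (\<lambda>x::real^3. flat p (c * x $ j + d))"
proof (induction k arbitrary: p)
  case 0
  have "continuous_on UNIV (flat p)"
    using flat_has_derivative by (meson DERIV_isCont continuous_at_imp_continuous_on)
  then show ?case
    by (auto intro!: continuous_on_compose2 [of UNIV "flat p"] continuous_intros)
next
  case (Suc k)
  define q where "q = [:0, 0, 1:] * (p - pderiv p)"
  have d: "((\<lambda>x::real^3. flat p (c * x $ j + d)) has_derivative
      (\<lambda>h. (c * h $ j) * flat q (c * x $ j + d))) (at x)" for x
  proof -
    have "((\<lambda>x::real^3. c * x $ j + d) has_derivative (\<lambda>h. c * h $ j)) (at x)"
      by (auto intro!: derivative_eq_intros bounded_linear.has_derivative [OF bounded_linear_vec_nth])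
    from has_derivative_compose [OF this flat_has_derivative [unfolded has_field_derivative_def]]
    show ?thesis
      by (simp add: q_def mult.commute)
  qed
  have "partial_deriv i (\<lambda>x::real^3. flat p (c * x $ j + d)) =
      (\<lambda>x. (c * axis i 1 $ j) * flat q (c * x $ j + d))" for i
    by (rule ext) (rule partial_deriv_eq [OF d])
  moreover have "(\<lambda>x::real^3. flat p (c * x $ j + d)) differentiable at x" for x
    using d differentiable_def by blast
  ultimately show ?case
    by (auto intro!: C_k_mult C_k_const Suc.IH)
qed

text \<open>\<open>flat 1 t\<close> is \<open>exp (- (1/t))\<close> for positive \<open>t\<close>,
  so each pair of factors vanishes outside the slab between two opposite faces. The growing factor
  \<open>Suc n\<close> pushes the values inside to one; it is never zero, so the nonzero set is the
  open box for every \<open>n\<close>.\<close>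

definition bump :: "real^3 \<Rightarrow> real^3 \<Rightarrow> nat \<Rightarrow> real^3 \<Rightarrow> real" where
  "bump a b n x = (\<Prod>i\<in>UNIV. flat 1 (Suc n * (x $ i - a $ i)) * flat 1 (Suc n * (b $ i - x $ i)))"

lemma C_k_bump: "C_k k (bump a b n)"
proof -
  have "C_k k (\<lambda>x. \<Prod>i\<in>UNIV. flat 1 (real (Suc n) * x $ i + - real (Suc n) * a $ i)
      * flat 1 (- real (Suc n) * x $ i + real (Suc n) * b $ i))"
    by (intro C_k_prod C_k_mult C_k_flat finite)
  then show ?thesis
    by (simp add: bump_def [abs_def] algebra_simps)
qed

lemma flat_one_bounds: "0 \<le> flat 1 t" "flat 1 t \<le> 1"
  by (auto simp: flat_def)

lemma bump_bounds: "0 \<le> bump a b n x" "bump a b n x \<le> 1"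
  unfolding bump_def
  by (auto intro!: prod_nonneg prod_le_1 mult_nonneg_nonneg mult_le_one flat_one_bounds)

lemma bump_nonzero_iff: "bump a b n x \<noteq> 0 \<longleftrightarrow> x \<in> box a b"
  by (auto simp: bump_def flat_def mem_box_cart zero_less_mult_iff)

lemma flat_one_tendsto:
  assumes t: "0 < t"
  shows "(\<lambda>n. flat 1 (real (Suc n) * t)) \<longlonglongrightarrow> 1"
proof -
  have "(\<lambda>n. exp (- (inverse (real (Suc n)) * inverse t))) \<longlonglongrightarrow> exp (- (0 * inverse t))"
    by (intro tendsto_intros LIMSEQ_inverse_real_of_nat)
  then show ?thesis
    using t by (simp add: flat_def divide_inverse del: of_nat_Suc)
qed

lemma bump_tendsto: "(\<lambda>n. bump a b n x) \<longlonglongrightarrow> indicator (box a b) x"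
proof (cases "x \<in> box a b")
  case True
  then have "(\<lambda>n. bump a b n x) \<longlonglongrightarrow> (\<Prod>i\<in>(UNIV::3 set). 1 * 1)"
    unfolding bump_def
    by (intro tendsto_prod tendsto_mult flat_one_tendsto) (auto simp: mem_box_cart)
  then show ?thesis
    using True by simp
next
  case False
  then have "bump a b n x = 0" for n
    using bump_nonzero_iff by blast
  then show ?thesis
    using False by simp
qed

section \<open>Integration by parts and the fundamental lemma\<close>

lemma integrable_compact_support:
  fixes f :: "'a::euclidean_space \<Rightarrow> 'b::{banach, second_countable_topology}"
  assumes "continuous_on UNIV f" "compact K" "\<And>x. x \<notin> K \<Longrightarrow> f x = 0"
  shows "integrable lborel f"
proof -
  have "integrable lborel (\<lambda>x. indicator K x *\<^sub>R f x)"
    using assms by (intro borel_integrable_compact) (auto intro: continuous_on_subset)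
  moreover have "(\<lambda>x. indicator K x *\<^sub>R f x) = f"
    using assms(3) by (auto simp: indicator_def)
  ultimately show ?thesis
    by simp
qed

lemma partial_deriv_outside:
  assumes "closed K" "\<And>x. x \<notin> K \<Longrightarrow> f x = 0" "x \<notin> K"
  shows "partial_deriv i f x = 0"
proof -
  have "((\<lambda>x. 0) has_derivative (\<lambda>h. 0)) (at x)"
    by simp
  then have "(f has_derivative (\<lambda>h. 0)) (at x)"
    by (rule has_derivative_transform_within_open [where s = "- K"]) (use assms in auto)
  then show ?thesis
    by (rule partial_deriv_eq)
qed

lemma integral_translation:
  fixes f :: "'a::euclidean_space \<Rightarrow> 'b::{banach, second_countable_topology}"
  assumes [measurable]: "f \<in> borel_measurable borel"
  shows "(\<integral>x. f (c + x) \<partial>lborel) = (\<integral>x. f x \<partial>lborel)"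
proof -
  have "(\<integral>x. f x \<partial>distr lborel borel ((+) c)) = (\<integral>x. f (c + x) \<partial>lborel)"
    by (rule integral_distr) measurable
  then show ?thesis
    by (simp add: lborel_distr_plus)
qed

text \<open>Difference quotients integrate to zero by translation invariance.\<close>

lemma integral_partial_deriv:
  fixes h :: "real^3 \<Rightarrow> 'b::euclidean_space"
  assumes C1: "C_k (Suc 0) h" and K: "compact K" "\<And>x. x \<notin> K \<Longrightarrow> h x = 0"
  shows "(\<integral>x. partial_deriv i h x \<partial>lborel) = 0"
proof -
  define e :: "real^3" where "e = axis i 1"
  define D where "D = partial_deriv i h"
  \<comment> \<open>Steps of length at most one: the supports of all difference quotients then stay
    within the ball of radius \<open>r + 1\<close> used below.\<close>
  define s where "s n = inverse (real (Suc n))" for n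
  define q where "q n x = real (Suc n) *\<^sub>R (h (s n *\<^sub>R e + x) - h x)" for n x
  have s: "0 < s n" "s n \<le> 1" "real (Suc n) * s n = 1" for n
    by (auto simp: s_def field_simps)
  have e: "norm e = 1"
    by (simp add: e_def)
  have cont: "continuous_on UNIV h" "continuous_on UNIV D"
    using C_k_continuous [OF C1] C1 by (auto simp: D_def)
  then have [measurable]: "h \<in> borel_measurable borel" "D \<in> borel_measurable borel"
    by (auto intro: borel_measurable_continuous_onI)
  have deriv: "(h has_derivative frechet_derivative h (at x)) (at x)" for x
    using C1 by (auto intro: differentiable_has_derivative)
  have path: "((\<lambda>t. h (t *\<^sub>R e + x)) has_derivative (\<lambda>r. r *\<^sub>R D (t *\<^sub>R e + x))) (at t)" for x t
  proof -
    have "((\<lambda>t. t *\<^sub>R e + x) has_derivative (\<lambda>r. r *\<^sub>R e)) (at t)"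
      by (auto intro!: derivative_eq_intros)
    from has_derivative_compose [OF this deriv] show ?thesis
      using linear_scale [OF has_derivative_linear [OF deriv]]
      by (simp add: D_def partial_deriv_def e_def)
  qed
  have "bounded (D ` K)"
    using K(1) cont(2) by (meson compact_continuous_image compact_imp_bounded continuous_on_subset subset_UNIV)
  then obtain B where B: "0 < B" "\<And>x. x \<in> K \<Longrightarrow> norm (D x) \<le> B"
    by (auto simp: bounded_pos)
  have D0: "D x = 0" if "x \<notin> K" for x
    unfolding D_def using partial_deriv_outside [OF compact_imp_closed [OF K(1)] K(2) that] .
  have DB: "norm (D x) \<le> B" for x
    using B D0 by (cases "x \<in> K") auto
  \<comment> \<open>The mean value inequality along the line through \<open>x\<close> bounds the
    quotients uniformly in \<open>n\<close>; with their common bounded support this gives an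
    integrable majorant.\<close>
  have qB: "norm (q n x) \<le> B" for n x
  proof -
    have "norm (h (s n *\<^sub>R e + x) - h (0 *\<^sub>R e + x)) \<le> B * norm (s n - 0)"
    proof (rule differentiable_bound [where S = UNIV])
      show "onorm (\<lambda>r. r *\<^sub>R D (t *\<^sub>R e + x)) \<le> B" for t
        by (intro onorm_le) (simp add: DB mult_left_mono mult.commute [of B])
    qed (use path in auto)
    then have le: "norm (h (s n *\<^sub>R e + x) - h x) \<le> B * s n"
      using s(1) [of n] by simp
    have "norm (q n x) = real (Suc n) * norm (h (s n *\<^sub>R e + x) - h x)"
      unfolding q_def norm_scaleR by simp
    also have "\<dots> \<le> real (Suc n) * (B * s n)"
      by (rule mult_left_mono [OF le]) simp
    also have "\<dots> = B * (real (Suc n) * s n)"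
      by (rule mult.left_commute)
    finally show ?thesis
      unfolding s(3) by simp
  qed
  obtain r where r: "K \<subseteq> cball 0 r"
    using compact_imp_bounded [OF K(1)] by (auto simp: bounded_iff subset_eq)
  have q0: "q n x = 0" if "x \<notin> cball 0 (r + 1)" for n x
  proof -
    have "r + 1 < norm x"
      using that by simp
    moreover have "norm x \<le> norm (s n *\<^sub>R e + x) + norm (s n *\<^sub>R e)"
      using norm_triangle_ineq4 [of "s n *\<^sub>R e + x" "s n *\<^sub>R e"] by simp
    moreover have "norm (s n *\<^sub>R e) \<le> 1"
      using s [of n] e by simp
    ultimately have "r < norm (s n *\<^sub>R e + x)" "r < norm x"
      by linarith+
    then have "x \<notin> K" "s n *\<^sub>R e + x \<notin> K"
      using r by auto
    then show ?thesis
      using K(2) by (simp add: q_def)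
  qed
  have "(\<lambda>n. \<integral>x. q n x \<partial>lborel) \<longlonglongrightarrow> (\<integral>x. D x \<partial>lborel)"
  proof (rule integral_dominated_convergence)
    show "q n \<in> borel_measurable lborel" for n
      unfolding q_def by measurable
    have "integrable lborel (\<lambda>x::real^3. indicator (cball 0 (r + 1)) x *\<^sub>R B)"
      by (intro borel_integrable_compact) auto
    then show "integrable lborel (\<lambda>x::real^3. B * indicator (cball 0 (r + 1)) x)"
      by (simp add: mult.commute)
    show "AE x in lborel. norm (q n x) \<le> B * indicator (cball 0 (r + 1)) x" for n
      using qB q0 by (auto simp: indicator_def)
    show "AE x in lborel. (\<lambda>n. q n x) \<longlonglongrightarrow> D x"
    proof (rule AE_I2)
      fix x
      have s0: "s \<longlonglongrightarrow> 0"
        unfolding s_def by (rule LIMSEQ_inverse_real_of_nat)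
      have lim: "((\<lambda>r. norm (h ((0 + r) *\<^sub>R e + x) - h (0 *\<^sub>R e + x) - r *\<^sub>R D (0 *\<^sub>R e + x)) / norm r) \<longlongrightarrow> 0) (at 0)"
        using path [of x 0] unfolding has_derivative_at by blast
      have "filterlim s (at 0) sequentially"
        unfolding filterlim_at using s0 s(1) by (simp add: less_imp_neq [symmetric])
      from filterlim_compose [OF lim this]
      have "(\<lambda>n. norm (h (s n *\<^sub>R e + x) - h x - s n *\<^sub>R D x) / norm (s n)) \<longlonglongrightarrow> 0"
        by simp
      moreover have "norm (h (s n *\<^sub>R e + x) - h x - s n *\<^sub>R D x) / norm (s n) = norm (q n x - D x)" for n
      proof -
        have "q n x - D x = real (Suc n) *\<^sub>R (h (s n *\<^sub>R e + x) - h x - s n *\<^sub>R D x)"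
          using s(3) [of n] by (simp add: q_def scaleR_diff_right del: of_nat_Suc)
        then show ?thesis
          by (simp add: s_def divide_inverse del: of_nat_Suc)
      qed
      ultimately show "(\<lambda>n. q n x) \<longlonglongrightarrow> D x"
        by (simp add: LIM_zero_iff tendsto_norm_zero_iff)
    qed
  qed measurable
  moreover have "(\<integral>x. q n x \<partial>lborel) = 0" for n
  proof -
    have h: "integrable lborel h"
      using integrable_compact_support cont(1) K by blast
    have "integrable lborel (\<lambda>x. h (s n *\<^sub>R e + x))"
    proof (rule integrable_compact_support)
      show "compact ((\<lambda>y. y - s n *\<^sub>R e) ` K)"
        using K(1) by (intro compact_continuous_image continuous_intros)
      show "h (s n *\<^sub>R e + x) = 0" if "x \<notin> (\<lambda>y. y - s n *\<^sub>R e) ` K" for x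
        using that K(2) by (metis add_diff_cancel_left' imageI)
    qed (auto intro!: continuous_on_compose2 [OF cont(1)] continuous_intros)
    then show ?thesis
      using h by (simp add: q_def integral_translation)
  qed
  ultimately show ?thesis
    unfolding D_def by (simp add: LIMSEQ_const_iff)
qed

text \<open>The support of \<open>g\<close> confines the product \<open>f * g\<close>, whose partial
  derivative therefore has integral zero.\<close>

lemma integral_by_parts:
  fixes f g :: "real^3 \<Rightarrow> 'k::rc_scalar"
  assumes f: "C_k (Suc 0) f" and g: "C_k (Suc 0) g" and K: "compact K" "\<And>x. x \<notin> K \<Longrightarrow> g x = 0"
  shows "(\<integral>x. f x * partial_deriv i g x \<partial>lborel) = - (\<integral>x. partial_deriv i f x * g x \<partial>lborel)"
    and "integrable lborel (\<lambda>x. f x * partial_deriv i g x)"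
    and "integrable lborel (\<lambda>x. partial_deriv i f x * g x)"
proof -
  have g': "partial_deriv i g x = 0" if "x \<notin> K" for x
    using partial_deriv_outside [OF compact_imp_closed [OF K(1)] K(2) that] .
  show int: "integrable lborel (\<lambda>x. f x * partial_deriv i g x)"
      "integrable lborel (\<lambda>x. partial_deriv i f x * g x)"
    using f g C_k_continuous [OF f] C_k_continuous [OF g] g' K(2)
    by (auto intro!: integrable_compact_support [OF _ K(1)] continuous_intros)
  have "partial_deriv i (\<lambda>x. f x * g x) = (\<lambda>x. f x * partial_deriv i g x + partial_deriv i f x * g x)"
    using f g by (intro ext partial_deriv_mult) auto
  moreover have "(\<integral>x. partial_deriv i (\<lambda>x. f x * g x) x \<partial>lborel) = 0"
    using integral_partial_deriv [OF C_k_mult [OF f g] K(1)] K(2) by simp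
  ultimately show "(\<integral>x. f x * partial_deriv i g x \<partial>lborel) = - (\<integral>x. partial_deriv i f x * g x \<partial>lborel)"
    using int by (simp add: add_eq_0_iff2)
qed

text \<open>Open boxes are an intersection-stable generator of the Borel sets, so vanishing of the
  integrals spreads from boxes to all Borel sets; uniqueness of densities then compares
  \<open>v\<close> with zero.\<close>

lemma AE_eq_0_on_box:
  fixes v :: "'a::euclidean_space \<Rightarrow> real"
  assumes v: "integrable lborel v" and v0: "\<And>x. x \<notin> box a b \<Longrightarrow> v x = 0"
    and boxes: "\<And>c d. cbox c d \<subseteq> cbox a b \<Longrightarrow> (\<integral>x. indicator (box c d) x * v x \<partial>lborel) = 0"
  shows "AE x in lborel. v x = 0"
proof -
  have [measurable]: "v \<in> borel_measurable lborel"
    using v by simp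
  have set: "set_integrable lborel A v" if "A \<in> sets borel" for A
    unfolding set_integrable_def using that v by (intro integrable_mult_indicator) auto
  have box: "(LINT x:box c d|lborel. v x) = 0" for c d
  proof -
    \<comment> \<open>An arbitrary box is cut down to \<open>box a b\<close>, off which
      \<open>v\<close> vanishes; only then does the hypothesis on boxes apply.\<close>
    obtain c' d' where eq: "box c d \<inter> box a b = box c' d'"
      unfolding box_Int_box by blast
    have "(LINT x:box c d|lborel. v x) = (\<integral>x. indicator (box c' d') x * v x \<partial>lborel)"
      unfolding set_lebesgue_integral_def eq [symmetric]
      by (rule Bochner_Integration.integral_cong) (use v0 in \<open>auto simp: indicator_def\<close>)
    also have "\<dots> = 0"
    proof (cases "box c' d' = {}")
      case False
      have "cbox c' d' \<subseteq> cbox a b"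
        using eq False by (metis Int_lower2 closure_box closure_mono box_eq_empty inf.absorb_iff2 inf_bot_right)
      then show ?thesis
        by (rule boxes)
    qed simp
    finally show ?thesis .
  qed
  have "(LINT x:A|lborel. v x) = 0" if "A \<in> sets borel" for A
  proof -
    have "Int_stable (range (\<lambda>(a, b). box a b :: 'a set))"
      by (auto simp: Int_stable_def box_Int_box)
    moreover have "range (\<lambda>(a, b). box a b :: 'a set) \<subseteq> Pow UNIV"
      by auto
    moreover have "A \<in> sigma_sets UNIV (range (\<lambda>(a, b). box a b))"
      using that unfolding borel_eq_box by simp
    ultimately show ?thesis
    proof (induction rule: sigma_sets_induct_disjoint)
      case (basic A)
      then show ?case
        using box by auto
    next
      case empty
      show ?case
        by (simp add: set_lebesgue_integral_def)
    next
      case (compl A)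
      have A: "A \<in> sets borel"
        using compl(1) unfolding borel_eq_box by simp
      \<comment> \<open>Passing to complements needs the total integral to vanish; it is the
        integral over \<open>box a b\<close>.\<close>
      have "(LINT x:UNIV|lborel. v x) = (LINT x:box a b|lborel. v x)"
        unfolding set_lebesgue_integral_def
        by (rule Bochner_Integration.integral_cong) (use v0 in \<open>auto simp: indicator_def\<close>)
      moreover have "(LINT x:UNIV|lborel. v x) = (LINT x:A|lborel. v x) + (LINT x:UNIV - A|lborel. v x)"
        using set_integral_Un [of A "UNIV - A" lborel v] A set by auto
      ultimately show ?case
        using box compl(2) by simp
    next
      case (union F)
      have "F i \<in> sets borel" for i
        using union(2) unfolding borel_eq_box by auto
      then have "(LINT x:(\<Union>i. F i)|lborel. v x) = (\<Sum>i. (LINT x:(F i)|lborel. v x))"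
        using union(1) by (intro lebesgue_integral_countable_add set) (auto simp: disjoint_family_on_def)
      then show ?case
        using union(3) by simp
    qed
  qed
  then show ?thesis
    using density_unique_real [OF v integrable_zero] by (simp add: set_lebesgue_integral_def)
qed

text \<open>Bumps converge to indicators of boxes, boxes generate the Borel sets, and countably many
  boxes cover \<open>\<Omega>\<close>. The detour in between is due to measurability:
  \<open>v\<close> is Lebesgue measurable on \<open>\<Omega>\<close>, whereas the generator argument
  concerns Borel functions on the whole space.\<close>

lemma bump_fundamental_lemma:
  fixes v :: "real^3 \<Rightarrow> real"
  assumes \<Omega>: "open \<Omega>" and v: "sq_integrable (lebesgue_on \<Omega>) v"
    and bump: "\<And>a b n. cbox a b \<subseteq> \<Omega> \<Longrightarrow> (\<integral>x. bump a b n x * v x \<partial>lebesgue_on \<Omega>) = 0"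
  shows "AE x in lebesgue_on \<Omega>. v x = 0"
proof -
  have [measurable]: "v \<in> borel_measurable (lebesgue_on \<Omega>)"
    using v by (simp add: sq_integrable_def)
  have \<Omega>_leb: "\<Omega> \<inter> space lebesgue \<in> sets lebesgue"
    using \<Omega> by simp
  have box_meas: "(\<lambda>x. indicator (box a b) x :: real) \<in> borel_measurable (lebesgue_on \<Omega>)" for a b :: "real^3"
    by (intro measurable_restrict_space1 borel_measurable_indicator sets_completionI_sets) simp
  have int: "integrable (lebesgue_on \<Omega>) (\<lambda>x. indicator (box a b) x * v x)" for a b
  proof (rule sq_integrable_integrable_bound [OF _ v])
    have "integrable lborel (\<lambda>x::real^3. indicator (box a b) x :: real)"
      by (rule integrable_real_indicator) (auto simp: emeasure_lborel_box_eq)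
    then have "integrable lebesgue (\<lambda>x::real^3. indicator (box a b) x :: real)"
      by (subst integrable_completion) auto
    then have "integrable lebesgue (\<lambda>x. indicator \<Omega> x *\<^sub>R (indicator (box a b) x :: real))"
      using \<Omega>_leb by (intro integrable_mult_indicator) auto
    then have "integrable (lebesgue_on \<Omega>) (\<lambda>x. indicator (box a b) x :: real)"
      by (subst integrable_restrict_space [OF \<Omega>_leb])
    then show "sq_integrable (lebesgue_on \<Omega>) (\<lambda>x. indicator (box a b) x :: real)"
      using box_meas by (auto simp: sq_integrable_def power2_eq_square indicator_inter_arith [symmetric])
    show "(\<lambda>x. indicator (box a b) x * v x) \<in> borel_measurable (lebesgue_on \<Omega>)"
      using box_meas by measurable
  qed (simp add: abs_mult)
  have box: "(\<integral>x. indicator (box a b) x * v x \<partial>lebesgue_on \<Omega>) = 0" if ab: "cbox a b \<subseteq> \<Omega>" for a b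
  proof -
    \<comment> \<open>Bumps lie between zero and one and vanish off the box, so the limit itself is
      a majorant; it is integrable because the box has finite measure.\<close>
    have "(\<lambda>n. \<integral>x. bump a b n x * v x \<partial>lebesgue_on \<Omega>) \<longlonglongrightarrow>
        (\<integral>x. indicator (box a b) x * v x \<partial>lebesgue_on \<Omega>)"
    proof (rule integral_dominated_convergence)
      show "(\<lambda>x. bump a b n x * v x) \<in> borel_measurable (lebesgue_on \<Omega>)" for n
      proof -
        have "bump a b n \<in> borel_measurable borel"
          using C_k_continuous [OF C_k_bump] by (rule borel_measurable_continuous_onI)
        then have "bump a b n \<in> borel_measurable (lebesgue_on \<Omega>)"
          by (intro measurable_restrict_space1 measurable_completion) simp
        then show ?thesis
          by measurable
      qed
      show "integrable (lebesgue_on \<Omega>) (\<lambda>x. \<bar>indicator (box a b) x * v x\<bar>)"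
        using int by (rule integrable_abs)
      show "AE x in lebesgue_on \<Omega>. (\<lambda>n. bump a b n x * v x) \<longlonglongrightarrow> indicator (box a b) x * v x"
        by (intro AE_I2 tendsto_mult bump_tendsto tendsto_const)
      show "AE x in lebesgue_on \<Omega>. norm (bump a b n x * v x) \<le> \<bar>indicator (box a b) x * v x\<bar>" for n
      proof (rule AE_I2)
        show "norm (bump a b n x * v x) \<le> \<bar>indicator (box a b) x * v x\<bar>" for x
          using bump_bounds [of a b n x] bump_nonzero_iff [of a b n x]
          by (cases "x \<in> box a b") (auto simp: abs_mult mult_left_le_one_le)
      qed
    qed (use int in auto)
    then show ?thesis
      using bump [OF ab] LIMSEQ_unique [OF _ tendsto_const] by simp
  qed
  have on_box: "AE x in lebesgue. x \<in> cbox a b \<longrightarrow> v x = 0" if ab: "cbox a b \<subseteq> \<Omega>" for a b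
  proof -
    \<comment> \<open>Cutting off to a box inside \<open>\<Omega>\<close> permits integration over
      the whole space, whatever the values of \<open>v\<close> off \<open>\<Omega>\<close>.\<close>
    define g where "g x = indicator (box a b) x * v x" for x
    have ind: "indicator \<Omega> x *\<^sub>R (indicator (box c d) x * g x) = indicator (box c d) x * g x" for c d x
      using ab box_subset_cbox [of a b] by (auto simp: g_def indicator_def)
    have ind': "indicator \<Omega> x *\<^sub>R g x = g x" for x
      using ab box_subset_cbox [of a b] by (auto simp: g_def indicator_def)
    have g: "integrable lebesgue g"
      using int [of a b] unfolding g_def [symmetric] integrable_restrict_space [OF \<Omega>_leb] ind' .
    then obtain g' where g': "g' \<in> borel_measurable lborel" "AE x in lborel. g x = g' x"
      using completion_ex_borel_measurable_real [of g lborel] by auto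
    note AE_g = AE_completion [OF g'(2)]
    \<comment> \<open>A Borel version of \<open>g\<close>, cut off once more because
      \<open>g'\<close> agrees with \<open>g\<close> only almost everywhere and may be nonzero off
      the box.\<close>
    define w where "w x = indicator (box a b) x * g' x" for x
    have w [measurable]: "w \<in> borel_measurable lborel"
      unfolding w_def using g'(1) by measurable
    have AE_w: "AE x in lebesgue. g x = w x"
      using AE_g by eventually_elim (auto simp: w_def g_def indicator_def)
    have w_leb: "w \<in> borel_measurable lebesgue"
      using w by (rule measurable_completion)
    have "integrable lebesgue w"
      using g AE_w w_leb by (subst integrable_cong_AE [of w _ g]) (auto elim: eventually_mono)
    then have w_int: "integrable lborel w"
      using w by (simp add: integrable_completion)
    have "AE x in lborel. w x = 0"
    proof (rule AE_eq_0_on_box [OF w_int])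
      show "w x = 0" if "x \<notin> box a b" for x
        using that by (simp add: w_def)
      fix c d
      assume cd: "cbox c d \<subseteq> cbox a b"
      have [measurable]: "(\<lambda>x. indicator (box c d) x * w x) \<in> borel_measurable lborel"
        by measurable
      have "(\<integral>x. indicator (box c d) x * w x \<partial>lborel) = (\<integral>x. indicator (box c d) x * w x \<partial>lebesgue)"
        by (rule integral_completion [symmetric]) measurable
      also have "\<dots> = (\<integral>x. indicator (box c d) x * g x \<partial>lebesgue)"
      proof (rule integral_cong_AE)
        show "(\<lambda>x. indicator (box c d) x * w x) \<in> borel_measurable lebesgue"
          by (rule measurable_completion) measurable
        show "(\<lambda>x. indicator (box c d) x * g x) \<in> borel_measurable lebesgue"
          using g by (intro borel_measurable_times borel_measurable_indicator) auto
        show "AE x in lebesgue. indicator (box c d) x * w x = indicator (box c d) x * g x"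
          using AE_w by eventually_elim simp
      qed
      also have "\<dots> = (\<integral>x. indicator (box c d) x * g x \<partial>lebesgue_on \<Omega>)"
        by (simp only: integral_restrict_space [OF \<Omega>_leb] ind)
      also have "\<dots> = (\<integral>x. indicator (box c d) x * v x \<partial>lebesgue_on \<Omega>)"
      proof (rule Bochner_Integration.integral_cong)
        show "indicator (box c d) x * g x = indicator (box c d) x * v x" for x
        proof (cases "x \<in> box c d")
          case True
          then have "box c d \<noteq> {}"
            by blast
          then have "box c d \<subseteq> box a b"
            using cd by (metis interior_cbox interior_mono)
          then show ?thesis
            using True by (auto simp: g_def)
        qed simp
      qed simp
      also have "\<dots> = 0"
        using box cd ab by blast
      finally show "(\<integral>x. indicator (box c d) x * w x \<partial>lborel) = 0" .
    qed
    then have "AE x in lebesgue. w x = 0"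
      by (rule AE_completion)
    \<comment> \<open>The faces are a null set, so the conclusion extends to the closed box, which
      is what the covering below consists of.\<close>
    moreover have "AE x in lebesgue. x \<notin> cbox a b - box a b"
      by (intro AE_completion AE_not_in null_sets_cbox_Diff_box)
    ultimately show ?thesis
      using AE_w by eventually_elim (auto simp: g_def)
  qed
  obtain \<D> where \<D>: "countable \<D>" "\<D> \<subseteq> Pow \<Omega>" "\<And>X. X \<in> \<D> \<Longrightarrow> \<exists>a b. X = cbox a b" "\<Union>\<D> = \<Omega>"
    using open_countable_Union_open_cbox [OF \<Omega>] by metis
  have "AE x in lebesgue. \<forall>X\<in>\<D>. x \<in> X \<longrightarrow> v x = 0"
  proof (subst AE_ball_countable [OF \<D>(1)], intro ballI)
    fix X
    assume "X \<in> \<D>"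
    then show "AE x in lebesgue. x \<in> X \<longrightarrow> v x = 0"
      using \<D>(2,3) on_box by blast
  qed
  then have "AE x in lebesgue. x \<in> \<Omega> \<longrightarrow> v x = 0"
    using \<D>(4) by (auto elim!: eventually_mono)
  then show ?thesis
    by (simp add: AE_restrict_space_iff [OF \<Omega>_leb])
qed

section \<open>Test fields and the weak curl\<close>

text \<open>Taking norms under the integral reduces the scalar-valued inequality to the real one for
  \<open>norm (f x)\<close> and \<open>norm (g x)\<close>.\<close>

lemma norm_integral_vdot_le:
  assumes f: "sq_integrable M f" and g: "sq_integrable M g"
  shows "(norm (\<integral>x. vdot (f x) (g x) \<partial>M))\<^sup>2 \<le>
    (\<integral>x. (norm (f x))\<^sup>2 \<partial>M) * (\<integral>x. (norm (g x))\<^sup>2 \<partial>M)"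
proof -
  have n: "sq_integrable M (\<lambda>x. norm (f x))" "sq_integrable M (\<lambda>x. norm (g x))"
    using f g by (auto simp: sq_integrable_def)
  have "norm (\<integral>x. vdot (f x) (g x) \<partial>M) \<le> (\<integral>x. norm (vdot (f x) (g x)) \<partial>M)"
    by (rule integral_norm_bound)
  also have "\<dots> \<le> (\<integral>x. inner (norm (f x)) (norm (g x)) \<partial>M)"
    by (intro integral_mono integrable_norm integrable_vdot f g integrable_inner_sq_integrable n)
      (simp add: norm_vdot_le)
  finally have "(norm (\<integral>x. vdot (f x) (g x) \<partial>M))\<^sup>2 \<le> (\<integral>x. inner (norm (f x)) (norm (g x)) \<partial>M)\<^sup>2"
    by (rule power_mono) simp
  also have "\<dots> \<le> (\<integral>x. (norm (f x))\<^sup>2 \<partial>M) * (\<integral>x. (norm (g x))\<^sup>2 \<partial>M)"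
    using integral_Cauchy_Schwarz [OF n] by simp
  finally show ?thesis .
qed

lemma tendsto_integral_vdot:
  assumes s: "\<And>n. sq_integrable M (s n)" and f: "sq_integrable M f" and g: "sq_integrable M g"
    and lim: "(\<lambda>n. \<integral>x. (norm (s n x - f x))\<^sup>2 \<partial>M) \<longlonglongrightarrow> 0"
  shows "(\<lambda>n. \<integral>x. vdot (s n x) (g x) \<partial>M) \<longlonglongrightarrow> (\<integral>x. vdot (f x) (g x) \<partial>M)"
proof -
  have d: "sq_integrable M (\<lambda>x. s n x - f x)" for n
    by (intro sq_integrable_diff s f)
  have "(\<lambda>n. (norm (\<integral>x. vdot (s n x - f x) (g x) \<partial>M))\<^sup>2) \<longlonglongrightarrow> 0"
  proof (rule tendsto_sandwich [OF _ _ tendsto_const])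
    show "(\<lambda>n. (\<integral>x. (norm (s n x - f x))\<^sup>2 \<partial>M) * (\<integral>x. (norm (g x))\<^sup>2 \<partial>M)) \<longlonglongrightarrow> 0"
      using tendsto_mult_left_zero [OF lim] .
  qed (auto intro!: always_eventually norm_integral_vdot_le [OF d g])
  then have "(\<lambda>n. \<integral>x. vdot (s n x - f x) (g x) \<partial>M) \<longlonglongrightarrow> 0"
    by (simp add: tendsto_null_power tendsto_norm_zero_iff)
  moreover have "vdot (s n x - f x) (g x) = vdot (s n x) (g x) - vdot (f x) (g x)" for n x
    by (simp add: vdot_def scalar_cnj_diff left_diff_distrib sum_subtractf)
  ultimately show ?thesis
    by (simp add: integrable_vdot s f g LIM_zero_iff)
qed

lemma ae_class_rep:
  assumes "U \<in> pts (L2 \<Omega>)"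
  shows "rep U \<in> square_integrable \<Omega>" "ae_class \<Omega> (rep U) = U"
proof -
  obtain f where f: "f \<in> square_integrable \<Omega>" "U = ae_class \<Omega> f"
    using assms by (auto simp: pts_L2_iff)
  show "rep U \<in> square_integrable \<Omega>"
    using rep_ae_class(1) f by blast
  then show "ae_class \<Omega> (rep U) = U"
    using rep_ae_class(2) [OF f(1)] f by (simp add: ae_class_eq_iff)
qed

section \<open>Test fields and their classical curl\<close>

lemma test_fieldsI:
  assumes "\<And>k. C_k k \<phi>" "compact K" "K \<subseteq> \<Omega>" "\<And>x. x \<notin> K \<Longrightarrow> \<phi> x = 0"
  shows "\<phi> \<in> test_fields \<Omega>"
proof -
  have "closure {x. \<phi> x \<noteq> 0} \<subseteq> K"
    using assms by (intro closure_minimal compact_imp_closed) auto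
  moreover from this have "compact (closure {x. \<phi> x \<noteq> 0})"
    using assms(2) by (meson bounded_subset closed_closure compact_eq_bounded_closed)
  ultimately show ?thesis
    using assms unfolding test_fields_def by blast
qed

lemma test_fieldsE:
  assumes "\<phi> \<in> test_fields \<Omega>"
  obtains K where "compact K" "K \<subseteq> \<Omega>" "\<And>x. x \<notin> K \<Longrightarrow> \<phi> x = 0"
proof
  show "compact (closure {x. \<phi> x \<noteq> 0})" "closure {x. \<phi> x \<noteq> 0} \<subseteq> \<Omega>"
    using assms by (auto simp: test_fields_def)
  show "\<phi> x = 0" if "x \<notin> closure {x. \<phi> x \<noteq> 0}" for x
    using that closure_subset [of "{x. \<phi> x \<noteq> 0}"] by blast
qed

lemma test_fields_C_k: "\<phi> \<in> test_fields \<Omega> \<Longrightarrow> C_k k \<phi>"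
  by (simp add: test_fields_def)

lemma test_fields_component: "\<phi> \<in> test_fields \<Omega> \<Longrightarrow> C_k k (\<lambda>x. \<phi> x $ i)"
  using test_fields_C_k C_k_bounded_linear [OF bounded_linear_vec_nth] by blast

lemma test_fields_component_differentiable:
  "\<phi> \<in> test_fields \<Omega> \<Longrightarrow> (\<lambda>x. \<phi> x $ i) differentiable at x"
  using test_fields_component [of \<phi> \<Omega> "Suc 0" i] by simp

lemma bounded_linear_vec_map:
  fixes L :: "'k::euclidean_space \<Rightarrow> 'k"
  assumes "bounded_linear L"
  shows "bounded_linear (\<lambda>v::'k^'n. \<chi> i. L (v $ i))"
  unfolding linear_conv_bounded_linear [symmetric]
  by (rule linearI)
    (simp_all add: vec_eq_iff linear_add linear_scale bounded_linear.linear [OF assms])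

text \<open>Real linearity of \<open>L\<close> suffices, so conjugation, real scaling and
  multiplication by a fixed scalar are all covered.\<close>

lemma test_fields_vec_map:
  fixes \<phi> :: "'k::rc_scalar vfield" and L :: "'k \<Rightarrow> 'k"
  assumes L: "bounded_linear L" and \<phi>: "\<phi> \<in> test_fields \<Omega>"
  shows "(\<lambda>x. \<chi> i. L (\<phi> x $ i)) \<in> test_fields \<Omega>"
proof -
  obtain K where K: "compact K" "K \<subseteq> \<Omega>" "\<And>x. x \<notin> K \<Longrightarrow> \<phi> x = 0"
    using test_fieldsE [OF \<phi>] by blast
  show ?thesis
  proof (rule test_fieldsI [OF _ K(1,2)])
    show "C_k k (\<lambda>x. \<chi> i. L (\<phi> x $ i))" for k
      using C_k_bounded_linear [OF bounded_linear_vec_map [OF L] test_fields_C_k [OF \<phi>]] .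
    show "(\<chi> i. L (\<phi> x $ i)) = 0" if "x \<notin> K" for x
      using K(3) [OF that] by (simp add: vec_eq_iff linear_simps(3) [OF L])
  qed
qed

lemma test_fields_add:
  assumes \<phi>: "\<phi> \<in> test_fields \<Omega>" and \<psi>: "\<psi> \<in> test_fields \<Omega>"
  shows "(\<lambda>x. \<phi> x + \<psi> x) \<in> test_fields \<Omega>"
proof -
  obtain K where K: "compact K" "K \<subseteq> \<Omega>" "\<And>x. x \<notin> K \<Longrightarrow> \<phi> x = 0"
    using test_fieldsE [OF \<phi>] by blast
  obtain K' where K': "compact K'" "K' \<subseteq> \<Omega>" "\<And>x. x \<notin> K' \<Longrightarrow> \<psi> x = 0"
    using test_fieldsE [OF \<psi>] by blast
  show ?thesis
    using K K' by (intro test_fieldsI [where K = "K \<union> K'"] C_k_add test_fields_C_k [OF \<phi>]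
        test_fields_C_k [OF \<psi>] compact_Un) auto
qed

lemma classical_curl_add:
  assumes "\<phi> \<in> test_fields \<Omega>" "\<psi> \<in> test_fields \<Omega>"
  shows "classical_curl (\<lambda>x. \<phi> x + \<psi> x) = (\<lambda>x. classical_curl \<phi> x + classical_curl \<psi> x)"
  using assms
  by (simp add: classical_curl_def fun_eq_iff vec_eq_iff forall_3 partial_deriv_add
      test_fields_component_differentiable)

lemma classical_curl_vec_map:
  fixes \<phi> :: "'k::rc_scalar vfield" and L :: "'k \<Rightarrow> 'k"
  assumes L: "bounded_linear L" and \<phi>: "\<phi> \<in> test_fields \<Omega>"
  shows "classical_curl (\<lambda>x. \<chi> i. L (\<phi> x $ i)) = (\<lambda>x. \<chi> i. L (classical_curl \<phi> x $ i))"
  by (simp add: classical_curl_def fun_eq_iff vec_eq_iff forall_3 linear_diff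
      partial_deriv_bounded_linear [OF L test_fields_component_differentiable [OF \<phi>]]
      bounded_linear.linear [OF L])

lemma continuous_on_classical_curl:
  fixes \<phi> :: "'k::rc_scalar vfield"
  assumes "\<phi> \<in> test_fields \<Omega>"
  shows "continuous_on UNIV (classical_curl \<phi>)"
proof -
  have "continuous_on UNIV (partial_deriv j (\<lambda>x. \<phi> x $ i))" for i j
    using test_fields_component [OF assms, of "Suc 0" i] by simp
  then have "continuous_on UNIV (\<lambda>x. classical_curl \<phi> x $ i)" for i
    using exhaust_3 [of i] by (auto simp: classical_curl_def intro!: continuous_on_diff)
  then have "continuous_on UNIV (\<lambda>x. \<chi> i. classical_curl \<phi> x $ i)"
    by (rule continuous_on_vec_lambda)
  then show ?thesis
    by simp
qed

lemma classical_curl_outside: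
  assumes "compact K" "\<And>x. x \<notin> K \<Longrightarrow> \<phi> x = 0" "x \<notin> K"
  shows "classical_curl \<phi> x = 0"
proof -
  have "partial_deriv j (\<lambda>x. \<phi> x $ i) x = 0" for i j
    using assms by (intro partial_deriv_outside [OF compact_imp_closed]) auto
  then show ?thesis
    by (simp add: classical_curl_def vec_eq_iff forall_3)
qed

text \<open>Passes from the measure on \<open>\<Omega>\<close> to the whole space, where integration
  by parts is available.\<close>

lemma lebesgue_on_compact_support:
  fixes f :: "'a::euclidean_space \<Rightarrow> 'b::{banach, second_countable_topology}"
  assumes \<Omega>: "open \<Omega>" and f: "continuous_on UNIV f" and K: "compact K" "K \<subseteq> \<Omega>"
    "\<And>x. x \<notin> K \<Longrightarrow> f x = 0"
  shows "integrable (lebesgue_on \<Omega>) f"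
    and "(\<integral>x. f x \<partial>lebesgue_on \<Omega>) = (\<integral>x. f x \<partial>lborel)"
proof -
  have \<Omega>_leb: "\<Omega> \<inter> space lebesgue \<in> sets lebesgue"
    using \<Omega> by simp
  have eq: "indicator \<Omega> x *\<^sub>R f x = f x" for x
    using K by (cases "x \<in> \<Omega>") auto
  have "f \<in> borel_measurable lborel"
    using f by (simp add: borel_measurable_continuous_onI)
  then show "integrable (lebesgue_on \<Omega>) f"
    and "(\<integral>x. f x \<partial>lebesgue_on \<Omega>) = (\<integral>x. f x \<partial>lborel)"
    using integrable_compact_support [OF f K(1,3)]
    by (auto simp: integrable_restrict_space [OF \<Omega>_leb] integral_restrict_space [OF \<Omega>_leb]
        eq integrable_completion integral_completion)
qed

lemma square_integrable_compact_support:
  fixes f :: "'k::rc_scalar vfield"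
  assumes "open \<Omega>" "continuous_on UNIV f" "compact K" "K \<subseteq> \<Omega>" "\<And>x. x \<notin> K \<Longrightarrow> f x = 0"
  shows "f \<in> square_integrable \<Omega>"
proof -
  have "continuous_on UNIV (\<lambda>x. (norm (f x))\<^sup>2)"
    by (intro continuous_intros assms)
  then show ?thesis
    using lebesgue_on_compact_support(1) [OF assms]
      lebesgue_on_compact_support(1) [of \<Omega> "\<lambda>x. (norm (f x))\<^sup>2" K] assms
    by (auto simp: square_integrable_def)
qed

lemma test_fields_square_integrable:
  assumes "open \<Omega>" "\<phi> \<in> test_fields \<Omega>"
  shows "\<phi> \<in> square_integrable \<Omega>" "classical_curl \<phi> \<in> square_integrable \<Omega>"
proof -
  obtain K where K: "compact K" "K \<subseteq> \<Omega>" "\<And>x. x \<notin> K \<Longrightarrow> \<phi> x = 0"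
    using test_fieldsE [OF assms(2)] by blast
  show "\<phi> \<in> square_integrable \<Omega>"
    by (rule square_integrable_compact_support [OF assms(1)
          C_k_continuous [OF test_fields_C_k [OF assms(2)]] K(1,2)]) (rule K(3))
  show "classical_curl \<phi> \<in> square_integrable \<Omega>"
    by (rule square_integrable_compact_support [OF assms(1)
          continuous_on_classical_curl [OF assms(2)] K(1,2)])
      (rule classical_curl_outside [OF K(1,3)])
qed

text \<open>Formal self-adjointness: each integration by parts contributes a minus sign, which the
  antisymmetry of the curl formula absorbs.\<close>

lemma integral_classical_curl:
  fixes \<phi> \<psi> :: "'k::rc_scalar vfield"
  assumes \<Omega>: "open \<Omega>" and \<phi>: "\<phi> \<in> test_fields \<Omega>" and \<psi>: "\<psi> \<in> test_fields \<Omega>"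
  shows "(\<integral>x. (\<Sum>i\<in>UNIV. \<phi> x $ i * classical_curl \<psi> x $ i) \<partial>lebesgue_on \<Omega>) =
    (\<integral>x. (\<Sum>i\<in>UNIV. classical_curl \<phi> x $ i * \<psi> x $ i) \<partial>lebesgue_on \<Omega>)"
proof -
  obtain K where K: "compact K" "K \<subseteq> \<Omega>" "\<And>x. x \<notin> K \<Longrightarrow> \<psi> x = 0"
    using test_fieldsE [OF \<psi>] by blast
  have cont: "continuous_on UNIV \<phi>" "continuous_on UNIV \<psi>"
    using C_k_continuous test_fields_C_k \<phi> \<psi> by blast+
  note cont' = continuous_on_classical_curl [OF \<phi>] continuous_on_classical_curl [OF \<psi>]
  note ip = integral_by_parts [OF test_fields_component [OF \<phi>] test_fields_component [OF \<psi>] K(1)]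
  have K0: "x \<notin> K \<Longrightarrow> \<psi> x $ i = 0" for x i
    using K(3) by simp
  have "(\<integral>x. (\<Sum>i\<in>UNIV. \<phi> x $ i * classical_curl \<psi> x $ i) \<partial>lborel) =
      (\<integral>x. (\<Sum>i\<in>UNIV. classical_curl \<phi> x $ i * \<psi> x $ i) \<partial>lborel)"
    by (simp add: sum_3 classical_curl_def right_diff_distrib left_diff_distrib ip K0)
  moreover have "(\<integral>x. (\<Sum>i\<in>UNIV. \<phi> x $ i * classical_curl \<psi> x $ i) \<partial>lebesgue_on \<Omega>) =
      (\<integral>x. (\<Sum>i\<in>UNIV. \<phi> x $ i * classical_curl \<psi> x $ i) \<partial>lborel)"
    using classical_curl_outside [OF K(1,3)]
    by (intro lebesgue_on_compact_support(2) [OF \<Omega> _ K(1,2)] continuous_intros cont cont') simp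
  moreover have "(\<integral>x. (\<Sum>i\<in>UNIV. classical_curl \<phi> x $ i * \<psi> x $ i) \<partial>lebesgue_on \<Omega>) =
      (\<integral>x. (\<Sum>i\<in>UNIV. classical_curl \<phi> x $ i * \<psi> x $ i) \<partial>lborel)"
    using K0
    by (intro lebesgue_on_compact_support(2) [OF \<Omega> _ K(1,2)] continuous_intros cont cont') simp
  ultimately show ?thesis
    by simp
qed

text \<open>A bump in one coordinate isolates one component of \<open>w\<close>, and a fixed
  \<open>c\<close> makes it real-valued; the finitely many \<open>c\<close> in \<open>Basis\<close>
  determine the component.\<close>

lemma fundamental_lemma:
  fixes w :: "'k::rc_scalar vfield"
  assumes \<Omega>: "open \<Omega>" and w: "w \<in> square_integrable \<Omega>"
    and ortho: "\<And>\<phi>. \<phi> \<in> test_fields \<Omega> \<Longrightarrow>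
      (\<integral>x. (\<Sum>i\<in>UNIV. w x $ i * \<phi> x $ i) \<partial>lebesgue_on \<Omega>) = 0"
  shows "AE x in lebesgue_on \<Omega>. w x = 0"
proof -
  have sq: "sq_integrable (lebesgue_on \<Omega>) w"
    using w by (simp add: square_integrable_iff)
  have "AE x in lebesgue_on \<Omega>. inner (w x $ i) c = 0" for i c
  proof (rule bump_fundamental_lemma [OF \<Omega>])
    show "sq_integrable (lebesgue_on \<Omega>) (\<lambda>x. inner (w x $ i) c)"
      using sq by (intro sq_integrable_bounded_linear [where L = "\<lambda>v. inner (v $ i) c"]
          bounded_linear_compose [OF bounded_linear_inner_left bounded_linear_vec_nth])
    fix a b n
    assume ab: "cbox a b \<subseteq> \<Omega>"
    define \<phi> :: "'k vfield" where "\<phi> x = axis i (of_real (bump a b n x))" for x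
    have lin: "bounded_linear (\<lambda>r::real. axis i (of_real r) :: 'k^3)"
      unfolding linear_conv_bounded_linear [symmetric]
      by (rule linearI) (auto simp: vec_eq_iff axis_def of_real_def scaleR_add_left)
    have \<phi>: "\<phi> \<in> test_fields \<Omega>"
    proof (rule test_fieldsI [OF _ compact_cbox ab])
      show "C_k k \<phi>" for k
        unfolding \<phi>_def using C_k_bounded_linear [OF lin C_k_bump] .
      show "\<phi> x = 0" if "x \<notin> cbox a b" for x
        using that bump_nonzero_iff [of a b n x] box_subset_cbox [of a b]
        by (auto simp: \<phi>_def vec_eq_iff axis_def)
    qed
    have \<phi>_sq: "sq_integrable (lebesgue_on \<Omega>) \<phi>"
      using test_fields_square_integrable(1) [OF \<Omega> \<phi>] by (simp add: square_integrable_iff)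
    have eq: "(\<Sum>j\<in>UNIV. w x $ j * \<phi> x $ j) = bump a b n x *\<^sub>R (w x $ i)" for x
      by (simp add: \<phi>_def axis_def if_distrib [of "\<lambda>t. _ * t"] scaleR_conv_of_real mult.commute
          cong: if_cong)
    have "integrable (lebesgue_on \<Omega>) (\<lambda>x. bump a b n x *\<^sub>R (w x $ i))"
    proof (rule sq_integrable_integrable_bound [OF \<phi>_sq sq])
      have "w \<in> borel_measurable (lebesgue_on \<Omega>)" "\<phi> \<in> borel_measurable (lebesgue_on \<Omega>)"
        using sq \<phi>_sq by (auto simp: sq_integrable_def)
      then show "(\<lambda>x. bump a b n x *\<^sub>R (w x $ i)) \<in> borel_measurable (lebesgue_on \<Omega>)"
        unfolding eq [symmetric]
        by (intro borel_measurable_sum borel_measurable_times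
            borel_measurable_continuous_on [OF linear_continuous_on [OF bounded_linear_vec_nth]])
      show "norm (bump a b n x *\<^sub>R (w x $ i)) \<le> norm (\<phi> x) * norm (w x)" for x
        using Finite_Cartesian_Product.norm_nth_le [of "\<phi> x" i] Finite_Cartesian_Product.norm_nth_le [of "w x" i]
        by (auto simp: \<phi>_def intro!: mult_mono)
    qed
    then have "(\<integral>x. inner (bump a b n x *\<^sub>R (w x $ i)) c \<partial>lebesgue_on \<Omega>) =
        inner (\<integral>x. bump a b n x *\<^sub>R (w x $ i) \<partial>lebesgue_on \<Omega>) c"
      by (intro integral_inner_left) simp
    also have "\<dots> = 0"
      using ortho [OF \<phi>] by (simp add: eq)
    finally show "(\<integral>x. bump a b n x * inner (w x $ i) c \<partial>lebesgue_on \<Omega>) = 0"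
      by simp
  qed
  then have "AE x in lebesgue_on \<Omega>. \<forall>i. \<forall>c\<in>Basis. inner (w x $ i) c = 0"
    by (simp add: AE_all_countable AE_ball_countable countable_finite)
  then show ?thesis
  proof eventually_elim
    case (elim x)
    have "w x $ i = 0" for i
      by (rule euclidean_eqI) (use elim in simp)
    then show ?case
      by (simp add: vec_eq_iff)
  qed
qed

section \<open>The weak curl as an adjoint\<close>

abbreviation cnj_field :: "'k::rc_scalar vfield \<Rightarrow> 'k vfield" where
  "cnj_field \<phi> \<equiv> (\<lambda>x. \<chi> i. scalar_cnj (\<phi> x $ i))"

lemma cnj_field_cnj_field: "cnj_field (cnj_field \<phi>) = \<phi>"
  by (simp add: fun_eq_iff vec_eq_iff)

lemma square_integrable_cnj_field:
  "\<phi> \<in> square_integrable \<Omega> \<Longrightarrow> cnj_field \<phi> \<in> square_integrable \<Omega>"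
  unfolding square_integrable_iff
  by (rule sq_integrable_bounded_linear [OF bounded_linear_vec_map [OF bounded_linear_scalar_cnj]])

lemma test_fields_cnj_field: "\<phi> \<in> test_fields \<Omega> \<Longrightarrow> cnj_field \<phi> \<in> test_fields \<Omega>"
  by (rule test_fields_vec_map [OF bounded_linear_scalar_cnj])

text \<open>Conjugating the test function turns the bilinear pairing of distributions into the
  sesquilinear inner product.\<close>

lemma integral_pairing_eq_ip_L2:
  fixes f :: "'k::rc_scalar vfield"
  assumes "U \<in> pts (L2 \<Omega>)" "f \<in> square_integrable \<Omega>"
  shows "(\<integral>x. (\<Sum>i\<in>UNIV. rep U x $ i * f x $ i) \<partial>lebesgue_on \<Omega>) =
    ip (L2 \<Omega>) (ae_class \<Omega> (cnj_field f)) U"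
proof -
  have "ip (L2 \<Omega>) (ae_class \<Omega> (cnj_field f)) (ae_class \<Omega> (rep U)) =
      (\<integral>x. vdot (cnj_field f x) (rep U x) \<partial>lebesgue_on \<Omega>)"
    using assms by (intro ip_L2 square_integrable_cnj_field ae_class_rep)
  then show ?thesis
    using assms by (simp add: ae_class_rep vdot_def mult.commute)
qed

definition test_curl ::
    "(real^3) set \<Rightarrow> (('k::rc_scalar) vfield set, 'k vfield set) operator" where
  "test_curl \<Omega> = {(ae_class \<Omega> \<phi>, ae_class \<Omega> (classical_curl \<phi>)) | \<phi>. \<phi> \<in> test_fields \<Omega>}"

text \<open>Conjugation is a bijection of the test fields that commutes with the classical curl, so
  it makes no difference whether all \<open>\<phi>\<close> or all their conjugates are
  tested.\<close>

lemma curl_iff: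
  fixes U V :: "'k::rc_scalar vfield set"
  assumes \<Omega>: "open \<Omega>"
  shows "(U, V) \<in> curl \<Omega> \<longleftrightarrow> U \<in> pts (L2 \<Omega>) \<and> V \<in> pts (L2 \<Omega>) \<and>
    (\<forall>(t, t')\<in>test_curl \<Omega>. ip (L2 \<Omega>) t' U = ip (L2 \<Omega>) t V)"
proof (cases "U \<in> pts (L2 \<Omega>) \<and> V \<in> pts (L2 \<Omega>)")
  case UV: True
  define Q :: "'k vfield \<Rightarrow> bool" where
    "Q \<phi> \<longleftrightarrow> ip (L2 \<Omega>) (ae_class \<Omega> (classical_curl \<phi>)) U = ip (L2 \<Omega>) (ae_class \<Omega> \<phi>) V" for \<phi>
  have "(\<integral>x. (\<Sum>i\<in>UNIV. rep U x $ i * classical_curl \<phi> x $ i) \<partial>lebesgue_on \<Omega>) =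
      (\<integral>x. (\<Sum>i\<in>UNIV. rep V x $ i * \<phi> x $ i) \<partial>lebesgue_on \<Omega>) \<longleftrightarrow> Q (cnj_field \<phi>)"
    if "\<phi> \<in> test_fields \<Omega>" for \<phi>
    using UV test_fields_square_integrable [OF \<Omega> that]
    by (simp add: Q_def integral_pairing_eq_ip_L2
        classical_curl_vec_map [OF bounded_linear_scalar_cnj that])
  then have "(U, V) \<in> curl \<Omega> \<longleftrightarrow> (\<forall>\<phi>\<in>test_fields \<Omega>. Q (cnj_field \<phi>))"
    using UV by (simp add: curl_def)
  also have "\<dots> \<longleftrightarrow> (\<forall>\<phi>\<in>test_fields \<Omega>. Q \<phi>)"
    using test_fields_cnj_field [where \<Omega> = \<Omega>] cnj_field_cnj_field by metis
  also have "\<dots> \<longleftrightarrow> (\<forall>(t, t')\<in>test_curl \<Omega>. ip (L2 \<Omega>) t' U = ip (L2 \<Omega>) t V)"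
    by (auto simp: test_curl_def Q_def)
  finally show ?thesis
    using UV by simp
qed (auto simp: curl_def)

lemma test_curl_subset_L2:
  assumes "open \<Omega>" "(t, t') \<in> test_curl \<Omega>"
  shows "t \<in> pts (L2 \<Omega>)" "t' \<in> pts (L2 \<Omega>)"
  using assms by (auto simp: test_curl_def intro: ae_class_in_L2 test_fields_square_integrable)

text \<open>Two weak curls have the same products with all test fields, and the fundamental lemma
  applies to a representative of their difference.\<close>

lemma curl_unique:
  fixes U V V' :: "'k::rc_scalar vfield set"
  assumes \<Omega>: "open \<Omega>" and V: "(U, V) \<in> curl \<Omega>" and V': "(U, V') \<in> curl \<Omega>"
  shows "V = V'"
proof -
  have pts: "V \<in> pts (L2 \<Omega>)" "V' \<in> pts (L2 \<Omega>)"
    using V V' by (auto simp: curl_def)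
  define W where "W = sub (L2 \<Omega>) V V'"
  have W: "W \<in> pts (L2 \<Omega>)"
    unfolding W_def using pts by (rule L2.sub_in)
  have "AE x in lebesgue_on \<Omega>. rep W x = 0"
  proof (rule fundamental_lemma [OF \<Omega> ae_class_rep(1) [OF W]])
    fix \<phi> :: "'k vfield"
    assume \<phi>: "\<phi> \<in> test_fields \<Omega>"
    define t t' where "t = ae_class \<Omega> (cnj_field \<phi>)" and "t' = ae_class \<Omega> (classical_curl (cnj_field \<phi>))"
    have t: "(t, t') \<in> test_curl \<Omega>"
      unfolding t_def t'_def test_curl_def using test_fields_cnj_field [OF \<phi>] by blast
    then have "ip (L2 \<Omega>) t V = ip (L2 \<Omega>) t V'"
      using V V' unfolding curl_iff [OF \<Omega>] by fastforce
    then have "ip (L2 \<Omega>) t W = 0"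
      using pts test_curl_subset_L2 [OF \<Omega> t] by (simp add: W_def L2.ip_sub)
    then show "(\<integral>x. (\<Sum>i\<in>UNIV. rep W x $ i * \<phi> x $ i) \<partial>lebesgue_on \<Omega>) = 0"
      using W test_fields_square_integrable [OF \<Omega> \<phi>] by (simp add: integral_pairing_eq_ip_L2 t_def)
  qed
  then have "ae_class \<Omega> (rep W) = ae_class \<Omega> (\<lambda>x. 0)"
    using ae_class_rep(1) [OF W]
    by (subst ae_class_eq_iff) (auto simp: square_integrable_iff sq_integrable_zero)
  then have "W = zer (L2 \<Omega>)"
    by (simp add: ae_class_rep [OF W] zer_L2)
  then show ?thesis
    using pts by (simp add: W_def L2.sub_eq_zer)
qed

section \<open>The closure of curl on test fields\<close>

lemma nrm_direct_sum_L2: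
  assumes "f \<in> square_integrable \<Omega>" "g \<in> square_integrable \<Omega>"
  shows "nrm (direct_sum (L2 \<Omega>) (L2 \<Omega>)) (ae_class \<Omega> f, ae_class \<Omega> g) =
    sqrt ((\<integral>x. (norm (f x))\<^sup>2 \<partial>lebesgue_on \<Omega>) + (\<integral>x. (norm (g x))\<^sup>2 \<partial>lebesgue_on \<Omega>))"
  using assms by (simp add: nrm_def direct_sum_def ip_L2_self flip: scaleR_add_left)

text \<open>Translates closure in the graph norm from classes to functions, for which the limit and
  completeness results are stated.\<close>

lemma curl_ring_iff:
  fixes f g :: "'k::rc_scalar vfield"
  assumes \<Omega>: "open \<Omega>" and f: "f \<in> square_integrable \<Omega>" and g: "g \<in> square_integrable \<Omega>"
  shows "(ae_class \<Omega> f, ae_class \<Omega> g) \<in> curl_ring \<Omega> \<longleftrightarrow>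
    (\<exists>\<phi>. (\<forall>n. \<phi> n \<in> test_fields \<Omega>) \<and>
      (\<lambda>n. \<integral>x. (norm (\<phi> n x - f x))\<^sup>2 \<partial>lebesgue_on \<Omega>) \<longlonglongrightarrow> 0 \<and>
      (\<lambda>n. \<integral>x. (norm (classical_curl (\<phi> n) x - g x))\<^sup>2 \<partial>lebesgue_on \<Omega>) \<longlonglongrightarrow> 0)"
    (is "_ \<longleftrightarrow> (\<exists>\<phi>. (\<forall>n. \<phi> n \<in> test_fields \<Omega>) \<and> (\<lambda>n. ?a \<phi> n) \<longlonglongrightarrow> 0 \<and> (\<lambda>n. ?b \<phi> n) \<longlonglongrightarrow> 0)")
proof -
  define X where "X = direct_sum (L2 \<Omega>) (L2 \<Omega> :: ('k vfield set, 'k) ip_space)"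
  define c where "c \<phi> = (ae_class \<Omega> \<phi>, ae_class \<Omega> (classical_curl \<phi>))" for \<phi> :: "'k vfield"
  have dist: "nrm X (sub X (c (\<phi> n)) (ae_class \<Omega> f, ae_class \<Omega> g)) = sqrt (?a \<phi> n + ?b \<phi> n)"
    if "\<phi> n \<in> test_fields \<Omega>" for \<phi> n
  proof -
    have "sub X (c (\<phi> n)) (ae_class \<Omega> f, ae_class \<Omega> g) =
        (ae_class \<Omega> (\<lambda>x. \<phi> n x - f x), ae_class \<Omega> (\<lambda>x. classical_curl (\<phi> n) x - g x))"
      using test_fields_square_integrable [OF \<Omega> that] f g
      by (simp add: X_def direct_sum_def c_def sub_L2)
    then show ?thesis
      using test_fields_square_integrable [OF \<Omega> that] f g
      by (simp add: X_def nrm_direct_sum_L2 square_integrable_iff sq_integrable_diff)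
  qed
  have lim: "(\<lambda>n. sqrt (?a \<phi> n + ?b \<phi> n)) \<longlonglongrightarrow> 0 \<longleftrightarrow> (\<lambda>n. ?a \<phi> n) \<longlonglongrightarrow> 0 \<and> (\<lambda>n. ?b \<phi> n) \<longlonglongrightarrow> 0" for \<phi>
  proof
    assume "(\<lambda>n. sqrt (?a \<phi> n + ?b \<phi> n)) \<longlonglongrightarrow> 0"
    then have "(\<lambda>n. (sqrt (?a \<phi> n + ?b \<phi> n))\<^sup>2) \<longlonglongrightarrow> 0\<^sup>2"
      by (rule tendsto_power)
    then have ab: "(\<lambda>n. ?a \<phi> n + ?b \<phi> n) \<longlonglongrightarrow> 0"
      by simp
    show "(\<lambda>n. ?a \<phi> n) \<longlonglongrightarrow> 0 \<and> (\<lambda>n. ?b \<phi> n) \<longlonglongrightarrow> 0"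
      by (intro conjI; rule tendsto_sandwich [OF _ _ tendsto_const ab]) auto
  next
    assume "(\<lambda>n. ?a \<phi> n) \<longlonglongrightarrow> 0 \<and> (\<lambda>n. ?b \<phi> n) \<longlonglongrightarrow> 0"
    then have "(\<lambda>n. sqrt (?a \<phi> n + ?b \<phi> n)) \<longlonglongrightarrow> sqrt (0 + 0)"
      by (intro tendsto_intros) auto
    then show "(\<lambda>n. sqrt (?a \<phi> n + ?b \<phi> n)) \<longlonglongrightarrow> 0"
      by simp
  qed
  have "(ae_class \<Omega> f, ae_class \<Omega> g) \<in> pts X"
    using f g by (simp add: X_def direct_sum_def ae_class_in_L2)
  then have "(ae_class \<Omega> f, ae_class \<Omega> g) \<in> curl_ring \<Omega> \<longleftrightarrow>
      (\<exists>s. (\<forall>n. s n \<in> test_curl \<Omega>) \<and> (\<lambda>n. nrm X (sub X (s n) (ae_class \<Omega> f, ae_class \<Omega> g))) \<longlonglongrightarrow> 0)"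
    by (simp add: curl_ring_def closure_op_def closure_in_def X_def test_curl_def)
  also have "\<dots> \<longleftrightarrow> (\<exists>\<phi>. (\<forall>n. \<phi> n \<in> test_fields \<Omega>) \<and>
      (\<lambda>n. nrm X (sub X (c (\<phi> n)) (ae_class \<Omega> f, ae_class \<Omega> g))) \<longlonglongrightarrow> 0)"
  proof
    assume "\<exists>s. (\<forall>n. s n \<in> test_curl \<Omega>) \<and> (\<lambda>n. nrm X (sub X (s n) (ae_class \<Omega> f, ae_class \<Omega> g))) \<longlonglongrightarrow> 0"
    then obtain s where s: "\<And>n. s n \<in> test_curl \<Omega>"
      "(\<lambda>n. nrm X (sub X (s n) (ae_class \<Omega> f, ae_class \<Omega> g))) \<longlonglongrightarrow> 0"
      by blast
    have "\<exists>\<phi>. \<phi> \<in> test_fields \<Omega> \<and> s n = c \<phi>" for n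
      using s(1) [of n] by (auto simp: test_curl_def c_def)
    then obtain \<phi> where "\<And>n. \<phi> n \<in> test_fields \<Omega>" "\<And>n. s n = c (\<phi> n)"
      by metis
    then show "\<exists>\<phi>. (\<forall>n. \<phi> n \<in> test_fields \<Omega>) \<and>
        (\<lambda>n. nrm X (sub X (c (\<phi> n)) (ae_class \<Omega> f, ae_class \<Omega> g))) \<longlonglongrightarrow> 0"
      using s(2) by auto
  next
    assume "\<exists>\<phi>. (\<forall>n. \<phi> n \<in> test_fields \<Omega>) \<and>
        (\<lambda>n. nrm X (sub X (c (\<phi> n)) (ae_class \<Omega> f, ae_class \<Omega> g))) \<longlonglongrightarrow> 0"
    then obtain \<phi> where "\<And>n. \<phi> n \<in> test_fields \<Omega>"
      "(\<lambda>n. nrm X (sub X (c (\<phi> n)) (ae_class \<Omega> f, ae_class \<Omega> g))) \<longlonglongrightarrow> 0"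
      by blast
    then show "\<exists>s. (\<forall>n. s n \<in> test_curl \<Omega>) \<and> (\<lambda>n. nrm X (sub X (s n) (ae_class \<Omega> f, ae_class \<Omega> g))) \<longlonglongrightarrow> 0"
      by (intro exI [of _ "\<lambda>n. c (\<phi> n)"]) (auto simp: test_curl_def c_def)
  qed
  also have "\<dots> \<longleftrightarrow> (\<exists>\<phi>. (\<forall>n. \<phi> n \<in> test_fields \<Omega>) \<and> (\<lambda>n. sqrt (?a \<phi> n + ?b \<phi> n)) \<longlonglongrightarrow> 0)"
    using dist by (auto cong: conj_cong)
  finally show ?thesis
    unfolding lim .
qed

lemma curl_ring_pts:
  assumes "(U, V) \<in> curl_ring \<Omega>"
  shows "U \<in> pts (L2 \<Omega>)" "V \<in> pts (L2 \<Omega>)"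
  using assms by (auto simp: curl_ring_def closure_op_def closure_in_def direct_sum_def)

text \<open>A linear relation on test pairs survives limits in the graph norm. It yields both the
  adjoint identity and the orthogonality on the closure.\<close>

lemma curl_ring_limit:
  fixes M M' Y Z :: "'k::rc_scalar vfield set"
  assumes \<Omega>: "open \<Omega>" and M: "(M, M') \<in> curl_ring \<Omega>"
    and Y: "Y \<in> pts (L2 \<Omega>)" and Z: "Z \<in> pts (L2 \<Omega>)"
    and T: "\<And>t t'. (t, t') \<in> test_curl \<Omega> \<Longrightarrow> ip (L2 \<Omega>) t Y + ip (L2 \<Omega>) t' Z = 0"
  shows "ip (L2 \<Omega>) M Y + ip (L2 \<Omega>) M' Z = 0"
proof -
  obtain f g y z where fg: "f \<in> square_integrable \<Omega>" "M = ae_class \<Omega> f"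
      "g \<in> square_integrable \<Omega>" "M' = ae_class \<Omega> g"
    and yz: "y \<in> square_integrable \<Omega>" "Y = ae_class \<Omega> y"
      "z \<in> square_integrable \<Omega>" "Z = ae_class \<Omega> z"
    using curl_ring_pts [OF M] Y Z unfolding pts_L2_iff by blast
  obtain \<phi> where \<phi>: "\<And>n. \<phi> n \<in> test_fields \<Omega>"
    and lim: "(\<lambda>n. \<integral>x. (norm (\<phi> n x - f x))\<^sup>2 \<partial>lebesgue_on \<Omega>) \<longlonglongrightarrow> 0"
      "(\<lambda>n. \<integral>x. (norm (classical_curl (\<phi> n) x - g x))\<^sup>2 \<partial>lebesgue_on \<Omega>) \<longlonglongrightarrow> 0"
    using M curl_ring_iff [OF \<Omega> fg(1,3)] fg(2,4) by blast
  note sq = test_fields_square_integrable [OF \<Omega> \<phi>]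
  have "(\<lambda>n. (\<integral>x. vdot (\<phi> n x) (y x) \<partial>lebesgue_on \<Omega>) +
        (\<integral>x. vdot (classical_curl (\<phi> n) x) (z x) \<partial>lebesgue_on \<Omega>)) \<longlonglongrightarrow>
      (\<integral>x. vdot (f x) (y x) \<partial>lebesgue_on \<Omega>) + (\<integral>x. vdot (g x) (z x) \<partial>lebesgue_on \<Omega>)"
    using sq fg yz by (intro tendsto_add tendsto_integral_vdot lim) (auto simp: square_integrable_iff)
  moreover have "(\<integral>x. vdot (\<phi> n x) (y x) \<partial>lebesgue_on \<Omega>) +
      (\<integral>x. vdot (classical_curl (\<phi> n) x) (z x) \<partial>lebesgue_on \<Omega>) = 0" for n
  proof -
    have "(ae_class \<Omega> (\<phi> n), ae_class \<Omega> (classical_curl (\<phi> n))) \<in> test_curl \<Omega>"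
      using \<phi> by (auto simp: test_curl_def)
    from T [OF this] show ?thesis
      using sq fg yz by (simp add: ip_L2)
  qed
  ultimately show ?thesis
    using sq fg yz by (simp add: ip_L2 LIMSEQ_const_iff)
qed

text \<open>Conjugating \<open>\<psi>\<close> turns the bilinear identity
  \<open>integral_classical_curl\<close> into a sesquilinear one.\<close>

lemma test_curl_subset_curl:
  fixes \<Omega> :: "(real^3) set"
  assumes \<Omega>: "open \<Omega>"
  shows "(test_curl \<Omega> :: ('k::rc_scalar vfield set, 'k vfield set) operator) \<subseteq> curl \<Omega>"
proof clarify
  fix U V :: "'k vfield set"
  assume UV: "(U, V) \<in> test_curl \<Omega>"
  then obtain \<phi> where \<phi>: "\<phi> \<in> test_fields \<Omega>" "U = ae_class \<Omega> \<phi>" "V = ae_class \<Omega> (classical_curl \<phi>)"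
    by (auto simp: test_curl_def)
  have "ip (L2 \<Omega>) t' U = ip (L2 \<Omega>) t V" if t: "(t, t') \<in> test_curl \<Omega>" for t t' :: "'k vfield set"
  proof -
    obtain \<psi> where \<psi>: "\<psi> \<in> test_fields \<Omega>" "t = ae_class \<Omega> \<psi>" "t' = ae_class \<Omega> (classical_curl \<psi>)"
      using t by (auto simp: test_curl_def)
    have "(\<integral>x. vdot (classical_curl \<psi> x) (\<phi> x) \<partial>lebesgue_on \<Omega>) =
        (\<integral>x. vdot (\<psi> x) (classical_curl \<phi> x) \<partial>lebesgue_on \<Omega>)"
      using integral_classical_curl [OF \<Omega> test_fields_cnj_field [OF \<psi>(1)] \<phi>(1)]
      by (simp add: classical_curl_vec_map [OF bounded_linear_scalar_cnj \<psi>(1)] vdot_def)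
    then show ?thesis
      using test_fields_square_integrable [OF \<Omega> \<phi>(1)] test_fields_square_integrable [OF \<Omega> \<psi>(1)]
      by (simp add: ip_L2 \<phi> \<psi>)
  qed
  then show "(U, V) \<in> curl \<Omega>"
    using test_curl_subset_L2 [OF \<Omega> UV] unfolding curl_iff [OF \<Omega>] by blast
qed

lemma test_curl_subset_curl_ring:
  fixes \<Omega> :: "(real^3) set"
  assumes \<Omega>: "open \<Omega>"
  shows "(test_curl \<Omega> :: ('k::rc_scalar vfield set, 'k vfield set) operator) \<subseteq> curl_ring \<Omega>"
proof clarify
  fix U V :: "'k vfield set"
  assume "(U, V) \<in> test_curl \<Omega>"
  then obtain \<phi> where \<phi>: "\<phi> \<in> test_fields \<Omega>" "U = ae_class \<Omega> \<phi>" "V = ae_class \<Omega> (classical_curl \<phi>)"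
    by (auto simp: test_curl_def)
  then show "(U, V) \<in> curl_ring \<Omega>"
    by (auto simp: curl_ring_iff [OF \<Omega>] test_fields_square_integrable [OF \<Omega>]
        intro!: exI [of _ "\<lambda>n. \<phi>"])
qed

lemma curl_ring_curl_ip:
  fixes M M' U V :: "'k::rc_scalar vfield set"
  assumes \<Omega>: "open \<Omega>" and M: "(M, M') \<in> curl_ring \<Omega>" and U: "(U, V) \<in> curl \<Omega>"
  shows "ip (L2 \<Omega>) M' U = ip (L2 \<Omega>) M V"
proof -
  have pts: "U \<in> pts (L2 \<Omega>)" "V \<in> pts (L2 \<Omega>)"
    using U by (auto simp: curl_def)
  have "ip (L2 \<Omega>) M (neg (L2 \<Omega>) V) + ip (L2 \<Omega>) M' U = 0"
  proof (rule curl_ring_limit [OF \<Omega> M L2.neg_in pts(1)])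
    fix t t' :: "'k vfield set"
    assume t: "(t, t') \<in> test_curl \<Omega>"
    then have "ip (L2 \<Omega>) t' U = ip (L2 \<Omega>) t V"
      using U unfolding curl_iff [OF \<Omega>] by blast
    then show "ip (L2 \<Omega>) t (neg (L2 \<Omega>) V) + ip (L2 \<Omega>) t' U = 0"
      using test_curl_subset_L2 [OF \<Omega> t] pts by (simp add: L2.ip_neg)
  qed fact
  then show ?thesis
    using curl_ring_pts [OF M] pts by (simp add: L2.ip_neg)
qed

text \<open>Test pairs belong to \<open>curl\<close> themselves, so the adjoint identity on the
  closure applies to them and can be read backwards by conjugate symmetry.\<close>

lemma curl_ring_subset_curl:
  fixes \<Omega> :: "(real^3) set"
  assumes \<Omega>: "open \<Omega>"
  shows "(curl_ring \<Omega> :: ('k::rc_scalar vfield set, 'k vfield set) operator) \<subseteq> curl \<Omega>"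
proof clarify
  fix M M' :: "'k vfield set"
  assume M: "(M, M') \<in> curl_ring \<Omega>"
  note pts = curl_ring_pts [OF M]
  have "ip (L2 \<Omega>) t' M = ip (L2 \<Omega>) t M'" if t: "(t, t') \<in> test_curl \<Omega>" for t t' :: "'k vfield set"
  proof -
    note tpts = test_curl_subset_L2 [OF \<Omega> t]
    have "(t, t') \<in> curl \<Omega>"
      using test_curl_subset_curl [OF \<Omega>] t by blast
    then have "ip (L2 \<Omega>) M' t = ip (L2 \<Omega>) M t'"
      by (rule curl_ring_curl_ip [OF \<Omega> M])
    then show ?thesis
      using L2.ip_commute [OF pts(2) tpts(1)] L2.ip_commute [OF pts(1) tpts(2)] by simp
  qed
  then show "(M, M') \<in> curl \<Omega>"
    using pts unfolding curl_iff [OF \<Omega>] by blast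
qed

text \<open>The projection takes place among pairs of fields, regarded as functions into one
  Euclidean space. It gives orthogonality for the real inner product, which becomes scalar-valued
  because test fields admit scalar multiples.\<close>

lemma curl_ring_projection:
  fixes U V :: "'k::rc_scalar vfield set"
  assumes \<Omega>: "open \<Omega>" and U: "U \<in> pts (L2 \<Omega>)" and V: "V \<in> pts (L2 \<Omega>)"
  obtains M M' where "(M, M') \<in> curl_ring \<Omega>"
    "\<And>N N'. (N, N') \<in> curl_ring \<Omega> \<Longrightarrow>
      ip (L2 \<Omega>) N (sub (L2 \<Omega>) U M) + ip (L2 \<Omega>) N' (sub (L2 \<Omega>) V M') = 0"
proof -
  obtain u v where u: "u \<in> square_integrable \<Omega>" "U = ae_class \<Omega> u"
    and v: "v \<in> square_integrable \<Omega>" "V = ae_class \<Omega> v"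
    using U V unfolding pts_L2_iff by blast
  define J where "J \<phi> = (\<lambda>x. (\<phi> x, classical_curl \<phi> x))" for \<phi> :: "'k vfield"
  define G where "G = J ` test_fields \<Omega>"
  have J: "sq_integrable (lebesgue_on \<Omega>) (J \<phi>)" if "\<phi> \<in> test_fields \<Omega>" for \<phi>
    using test_fields_square_integrable [OF \<Omega> that]
    by (simp add: J_def square_integrable_iff sq_integrable_Pair)
  have uv: "sq_integrable (lebesgue_on \<Omega>) (\<lambda>x. (u x, v x))"
    using u v by (simp add: square_integrable_iff sq_integrable_Pair)
  have zero: "(\<lambda>x. 0) \<in> (test_fields \<Omega> :: 'k vfield set)"
    by (rule test_fieldsI [OF C_k_const compact_empty]) auto
  have lin: "(\<lambda>x. m x + c *\<^sub>R n x) \<in> G" if mn: "m \<in> G" "n \<in> G" for m n c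
  proof -
    obtain \<phi> \<psi> where \<phi>: "\<phi> \<in> test_fields \<Omega>" "m = J \<phi>" and \<psi>: "\<psi> \<in> test_fields \<Omega>" "n = J \<psi>"
      using mn by (auto simp: G_def)
    define \<xi> where "\<xi> = (\<lambda>x. \<chi> i. c *\<^sub>R (\<psi> x $ i))"
    have \<xi>: "\<xi> \<in> test_fields \<Omega>"
      unfolding \<xi>_def by (rule test_fields_vec_map [OF bounded_linear_scaleR_right \<psi>(1)])
    have "classical_curl (\<lambda>x. \<phi> x + \<xi> x) = (\<lambda>x. classical_curl \<phi> x + c *\<^sub>R classical_curl \<psi> x)"
      unfolding classical_curl_add [OF \<phi>(1) \<xi>]
      unfolding \<xi>_def classical_curl_vec_map [OF bounded_linear_scaleR_right \<psi>(1)]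
      by (simp add: fun_eq_iff vec_eq_iff)
    then have "(\<lambda>x. m x + c *\<^sub>R n x) = J (\<lambda>x. \<phi> x + \<xi> x)"
      by (simp add: J_def \<phi> \<psi> \<xi>_def fun_eq_iff vec_eq_iff)
    then show ?thesis
      using test_fields_add [OF \<phi>(1) \<xi>] by (simp add: G_def)
  qed
  obtain s p where s: "\<And>n. s n \<in> G" and p: "sq_integrable (lebesgue_on \<Omega>) p"
    and lim: "(\<lambda>n. \<integral>x. (norm (s n x - p x))\<^sup>2 \<partial>lebesgue_on \<Omega>) \<longlonglongrightarrow> 0"
    and orth: "\<And>n. n \<in> G \<Longrightarrow> (\<integral>x. inner (n x) ((u x, v x) - p x) \<partial>lebesgue_on \<Omega>) = 0"
    by (rule sq_integrable_projection [of G, OF _ _ lin uv]) (use J zero in \<open>auto simp: G_def\<close>)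
  define f g where "f x = fst (p x)" and "g x = snd (p x)" for x
  have f: "f \<in> square_integrable \<Omega>" and g: "g \<in> square_integrable \<Omega>"
    unfolding f_def g_def square_integrable_iff
    by (rule sq_integrable_bounded_linear [OF _ p]; rule bounded_linear_fst bounded_linear_snd)+
  have "\<exists>\<phi>. \<phi> \<in> test_fields \<Omega> \<and> s n = J \<phi>" for n
    using s [of n] by (auto simp: G_def)
  then obtain \<phi> where \<phi>: "\<And>n. \<phi> n \<in> test_fields \<Omega>" "\<And>n. s n = J (\<phi> n)"
    by metis
  note \<phi>_sq = test_fields_square_integrable [OF \<Omega> \<phi>(1)]
  have "(norm (s n x - p x))\<^sup>2 = (norm (\<phi> n x - f x))\<^sup>2 + (norm (classical_curl (\<phi> n) x - g x))\<^sup>2" for n x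
    by (cases "p x") (simp add: \<phi>(2) J_def f_def g_def norm_Pair)
  then have lim': "(\<lambda>n. (\<integral>x. (norm (\<phi> n x - f x))\<^sup>2 \<partial>lebesgue_on \<Omega>) +
      (\<integral>x. (norm (classical_curl (\<phi> n) x - g x))\<^sup>2 \<partial>lebesgue_on \<Omega>)) \<longlonglongrightarrow> 0"
    using lim \<phi>_sq f g
    by (simp add: integrable_norm_power2 sq_integrable_diff square_integrable_iff)
  have "(\<lambda>n. \<integral>x. (norm (\<phi> n x - f x))\<^sup>2 \<partial>lebesgue_on \<Omega>) \<longlonglongrightarrow> 0"
    "(\<lambda>n. \<integral>x. (norm (classical_curl (\<phi> n) x - g x))\<^sup>2 \<partial>lebesgue_on \<Omega>) \<longlonglongrightarrow> 0"
    by (rule tendsto_sandwich [OF _ _ tendsto_const lim']; simp)+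
  then have R: "(ae_class \<Omega> f, ae_class \<Omega> g) \<in> curl_ring \<Omega>"
    using \<phi>(1) unfolding curl_ring_iff [OF \<Omega> f g] by blast
  define a b where "a x = u x - f x" and "b x = v x - g x" for x
  have a: "a \<in> square_integrable \<Omega>" and b: "b \<in> square_integrable \<Omega>"
    unfolding a_def b_def using u v f g by (simp_all add: square_integrable_iff sq_integrable_diff)
  have sub: "sub (L2 \<Omega>) U (ae_class \<Omega> f) = ae_class \<Omega> a" "sub (L2 \<Omega>) V (ae_class \<Omega> g) = ae_class \<Omega> b"
    unfolding a_def b_def using u v f g by (simp_all add: sub_L2)
  define z where "z \<psi> = (\<integral>x. vdot (\<psi> x) (a x) \<partial>lebesgue_on \<Omega>) +
      (\<integral>x. vdot (classical_curl \<psi> x) (b x) \<partial>lebesgue_on \<Omega>)" for \<psi>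
  \<comment> \<open>The product in the Euclidean target sees only the real part of
    \<open>z \<psi>\<close>.\<close>
  have real: "inner 1 (z \<psi>) = 0" if \<psi>: "\<psi> \<in> test_fields \<Omega>" for \<psi>
  proof -
    note \<psi>_sq = test_fields_square_integrable [OF \<Omega> \<psi>]
    have "inner (J \<psi> x) ((u x, v x) - p x) = inner (\<psi> x) (a x) + inner (classical_curl \<psi> x) (b x)" for x
      by (cases "p x") (simp add: J_def a_def b_def f_def g_def)
    then have "(\<integral>x. inner (\<psi> x) (a x) + inner (classical_curl \<psi> x) (b x) \<partial>lebesgue_on \<Omega>) = 0"
      using orth [of "J \<psi>"] \<psi> by (simp add: G_def)
    moreover have "inner 1 (z \<psi>) =
        (\<integral>x. inner (\<psi> x) (a x) + inner (classical_curl \<psi> x) (b x) \<partial>lebesgue_on \<Omega>)"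
      using \<psi>_sq a b
      by (simp add: z_def inner_add_right integrable_vdot integrable_inner_sq_integrable
          square_integrable_iff inner_one_vdot flip: integral_inner_right)
    ultimately show ?thesis
      by simp
  qed
  have z: "z \<psi> = 0" if \<psi>: "\<psi> \<in> test_fields \<Omega>" for \<psi>
  proof -
    \<comment> \<open>Scaling the test field by \<open>z \<psi>\<close> itself replaces the value by
      \<open>scalar_cnj (z \<psi>) * z \<psi>\<close>, whose real part is the squared norm of
      \<open>z \<psi>\<close>.\<close>
    define \<psi>' where "\<psi>' = (\<lambda>x. \<chi> i. z \<psi> * \<psi> x $ i)"
    have "z \<psi>' = scalar_cnj (z \<psi>) * z \<psi>"
      unfolding z_def [of \<psi>'] unfolding \<psi>'_def
        classical_curl_vec_map [OF bounded_linear_mult_right \<psi>] vdot_mult_left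
      by (simp add: z_def [of \<psi>] distrib_left)
    then have "inner (z \<psi>) (z \<psi>) = 0"
      using real [of \<psi>'] test_fields_vec_map [OF bounded_linear_mult_right \<psi>]
      by (simp only: inner_one_scalar_cnj \<psi>'_def)
    then show ?thesis
      by simp
  qed
  have "ip (L2 \<Omega>) N (ae_class \<Omega> a) + ip (L2 \<Omega>) N' (ae_class \<Omega> b) = 0"
    if N: "(N, N') \<in> curl_ring \<Omega>" for N N'
  proof (rule curl_ring_limit [OF \<Omega> N])
    fix t t' :: "'k vfield set"
    assume "(t, t') \<in> test_curl \<Omega>"
    then obtain \<psi> where "\<psi> \<in> test_fields \<Omega>" "t = ae_class \<Omega> \<psi>" "t' = ae_class \<Omega> (classical_curl \<psi>)"
      by (auto simp: test_curl_def)
    then show "ip (L2 \<Omega>) t (ae_class \<Omega> a) + ip (L2 \<Omega>) t' (ae_class \<Omega> b) = 0"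
      using z [of \<psi>] test_fields_square_integrable [OF \<Omega>, of \<psi>] a b by (simp add: ip_L2 z_def)
  qed (use a b in \<open>auto intro: ae_class_in_L2\<close>)
  with R sub that show ?thesis
    by metis
qed

lemma adjoint_of_symmetric_curl:
  assumes \<Omega>: "open \<Omega>"
  shows "adjoint_of_symmetric (L2 \<Omega> :: ('k::rc_scalar vfield set, 'k) ip_space)
    (test_curl \<Omega>) (curl_ring \<Omega>) (curl \<Omega>)"
proof
  fix U V :: "'k vfield set"
  show "(U, V) \<in> curl \<Omega> \<longleftrightarrow> U \<in> pts (L2 \<Omega>) \<and> V \<in> pts (L2 \<Omega>) \<and>
      (\<forall>(t, t')\<in>test_curl \<Omega>. ip (L2 \<Omega>) t' U = ip (L2 \<Omega>) t V)"
    by (rule curl_iff [OF \<Omega>])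
  assume "(U, V) \<in> curl \<Omega>"
  then have "U \<in> pts (L2 \<Omega>)" "V \<in> pts (L2 \<Omega>)"
    by (auto simp: curl_def)
  then obtain M M' where "(M, M') \<in> curl_ring \<Omega>" "\<And>N N'. (N, N') \<in> curl_ring \<Omega> \<Longrightarrow>
      ip (L2 \<Omega>) N (sub (L2 \<Omega>) U M) + ip (L2 \<Omega>) N' (sub (L2 \<Omega>) V M') = 0"
    using curl_ring_projection [OF \<Omega>] by blast
  then show "\<exists>(m, m')\<in>curl_ring \<Omega>. \<forall>(n, n')\<in>curl_ring \<Omega>.
      ip (L2 \<Omega>) n (sub (L2 \<Omega>) U m) + ip (L2 \<Omega>) n' (sub (L2 \<Omega>) V m') = 0"
    by blast
qed (use test_curl_subset_curl_ring [OF \<Omega>] curl_ring_subset_curl [OF \<Omega>] curl_ring_curl_ip [OF \<Omega>]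
    curl_unique [OF \<Omega>] in blast)+

theorem theorem2p24:
  fixes \<Omega> :: "(real^3) set"
  assumes "\<Omega> \<noteq> {}" and "open \<Omega>"
  shows "adjoint_op (L2 \<Omega>) (direct_sum (L2 \<Omega>) (BD_curl \<Omega>)) (neg_curl_iota_adj \<Omega>)
           \<subseteq> (neg_curl_zero \<Omega> ::
               (('k::rc_scalar) vfield set \<times> 'k vfield set, 'k vfield set) operator) \<and>
         Domain (adjoint_op (L2 \<Omega>) (direct_sum (L2 \<Omega>) (BD_curl \<Omega>)) (neg_curl_iota_adj \<Omega>))
           = {(E :: 'k vfield set, \<eta>).
               E \<in> Domain (curl \<Omega>) \<and> \<eta> \<in> pts (BD_curl \<Omega>) \<and>
               sub (BD_curl \<Omega>) (app (iota_curl_adj \<Omega>) E) (app (curl_bullet \<Omega>) \<eta>)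
                 = zer (BD_curl \<Omega>)}"
proof -
  interpret C: adjoint_of_symmetric "L2 \<Omega> :: ('k vfield set, 'k) ip_space"
    "test_curl \<Omega>" "curl_ring \<Omega>" "curl \<Omega>"
    by (rule adjoint_of_symmetric_curl [OF assms(2)])
  have H: "C.H = H_curl \<Omega>"
    by (simp add: C.H_def H_curl_def)
  then have BD: "C.BD = BD_curl \<Omega>"
    by (simp add: C.BD_def BD_curl_def)
  then have \<iota>: "C.\<iota>_adj = iota_curl_adj \<Omega>"
    by (simp add: C.\<iota>_adj_def iota_curl_adj_def iota_curl_def H)
  then have bullet: "C.bullet = curl_bullet \<Omega>"
    by (simp add: C.bullet_def curl_bullet_def iota_curl_def BD)
  have stacked: "C.stacked = neg_curl_iota_adj \<Omega>"
    by (simp add: C.stacked_def neg_curl_iota_adj_def \<iota>)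
  show ?thesis
    using C.adjoint_stacked unfolding BD \<iota> bullet stacked neg_curl_zero_def by blast
qed

end
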